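(* Let $\hat\tau\in\mathbb N$ and $g:=\lceil 5\cdot n_{\mathcal L}\cdot\hat\tau\cdot\log\hat\tau\rceil$. For every $\varepsilon>0$ there exist $k_\varepsilon\in\mathbb N$ and $\delta>0$ such that if $\mathcal M$ is a finite $\mathcal L$-structure with underlying set $M$, $|M|\ge k_\varepsilon$, and $\mathcal M$ does not have the $(\delta,\hat\tau)$-branching property, then there exist an $\mathcal L$-structure $\mathcal N$ with underlying set $M$ and an equitable partition $P$ of $M$ such that (i) $|E^{\mathcal M}\triangle E^{\mathcal N}|\le \mathrm{arity}(E)\cdot\varepsilon\cdot|M|^{\mathrm{arity}(E)}$ for all $E\in\mathcal L$; (ii) $P$ is indivisible with respect to $\mathcal N$; (iii) $|P|\le(\frac{\varepsilon}{2})^{-g-2}$.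
   Context: $\mathcal{L}$ is a fixed finite relational language (equality is logical, not in $\mathcal L$); $q_{\mathcal L}:=\max\{\mathrm{arity}(E):E\in\mathcal L\}$, $n_{\mathcal L}:=|\mathcal L|\cdot q_{\mathcal L}$; logarithms base 2; $E^{\mathcal M}$ is the interpretation of $E$. Branching property: a quantifier-free formula $\varphi(\bar x;\bar y)$ has the $\hat\tau$-branching property in $\mathcal M$ if there are tuples $\langle\bar a_i\rangle_{i\in\{0,1\}^{\hat\tau}}$ (length $|\bar x|$) and $\langle\bar b_j\rangle_{j\in\{0,1\}^{<\hat\tau}}$ (length $|\bar y|$) from $\mathcal M$ such that whenever $j^\frown h$ ($h\in\{0,1\}$) is an initial segment of $i$, $\mathcal M\models\varphi(\bar a_i;\bar b_j)$ iff $h=1$. A structure $\mathcal F$ minimally has the $\hat\tau$-branching property for $\varphi$ if it has the $\hat\tau$-branching property for $\varphi$ and no proper induced substructure of it does. Induced homomorphism density: for finite $\mathcal L$-structures $\mathcal F$ (with $k$ elements) and $\mathcal N$ (with $n$ elements), $t_{\mathrm{ind}}(\mathcal F,\mathcal N):=|\mathrm{ind}(\mathcal F,\mathcal N)|/(n(n-1)\cdots(n-k+1))$, where $\mathrm{ind}(\mathcal F,\mathcal N)$ is the set of embeddings of $\mathcal F$ into $\mathcal N$ (injective maps preserving all relations and their negations). For $\delta>0$, $\mathcal M$ has the $(\delta,\hat\tau)$-branching property for $\varphi$ if there is a structure $\mathcal F$ that minimally has the $\hat\tau$-branching property for $\varphi$ with $t_{\mathrm{ind}}(\mathcal F,\mathcal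 M)\ge\delta$; $\mathcal M$ has the $(\delta,\hat\tau)$-branching property if this holds for $\varphi=E(x_0,\dots,x_{\mathrm{arity}(E)-1})$ for some $E\in\mathcal L$ with some partition $(x_j;\text{other variables})$ of its variables. A partition $P$ of $M$ is equitable if any two parts differ in size by at most 1; indivisible with respect to $\mathcal N$ if for every $E\in\mathcal L$ of arity $k$, parts $p_0,\dots,p_{k-1}$ and $a^0_i,a^1_i\in p_i$, $\mathcal N\models E(\bar a^0)\leftrightarrow E(\bar a^1)$.
   Formalization: The formal theorem assumes ε ≤ 2: for ε > 2 the bound (iii) is below 1, which no partition of a nonempty M meets (e.g. all relations empty, τ̂ ≥ 1). Structures have universes in one arbitrary fixed type, which with the natural numbers covers all finite structures up to isomorphism. *)

theory Defs
  imports Complex_Main "HOL-Library.FuncSet" "HOL-Library.Disjoint_Sets" "HOL-Library.Sublist"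
begin

text \<open>
  A finite relational language is a finite set \<open>L\<close> of symbols with an arity function \<open>ar\<close>.
  \<open>L = {}\<close> and symbols of arity 0 are allowed.
\<close>

definition max_arity :: "'s set \<Rightarrow> ('s \<Rightarrow> nat) \<Rightarrow> nat" where
  "max_arity L ar = Max (ar ` L)"

text \<open>For \<open>L = {}\<close> the maximum is unspecified, but the factor \<open>card L = 0\<close> makes it irrelevant.\<close>

definition lang_size :: "'s set \<Rightarrow> ('s \<Rightarrow> nat) \<Rightarrow> nat" where
  "lang_size L ar = card L * max_arity L ar"

record ('s, 'a) rel_structure =
  univ :: "'a set"
  rel :: "'s \<Rightarrow> 'a list set"

text \<open>The interpretation of symbols outside \<open>L\<close> is arbitrary and never used.\<close>

definition is_structure :: "'s set \<Rightarrow> ('s \<Rightarrow> nat) \<Rightarrow> ('s, 'a) rel_structure \<Rightarrow> bool" where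
  "is_structure L ar M \<longleftrightarrow>
    (\<forall>E\<in>L. rel M E \<subseteq> {t. length t = ar E \<and> set t \<subseteq> univ M})"

definition induced :: "('s, 'a) rel_structure \<Rightarrow> 'a set \<Rightarrow> ('s, 'a) rel_structure" where
  "induced M A = \<lparr>univ = A, rel = (\<lambda>E. {t \<in> rel M E. set t \<subseteq> A})\<rparr>"

datatype 's qf_formula =
    Equal nat nat
  | Atom 's "nat list"
  | Neg "'s qf_formula"
  | Conj "'s qf_formula" "'s qf_formula"

primrec sat :: "('s, 'a) rel_structure \<Rightarrow> (nat \<Rightarrow> 'a) \<Rightarrow> 's qf_formula \<Rightarrow> bool" where
  "sat M v (Equal x y) \<longleftrightarrow> v x = v y"
| "sat M v (Atom E xs) \<longleftrightarrow> map v xs \<in> rel M E"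
| "sat M v (Neg p) \<longleftrightarrow> \<not> sat M v p"
| "sat M v (Conj p q) \<longleftrightarrow> sat M v p \<and> sat M v q"

text \<open>
  A partitioned formula is a formula \<open>p\<close> together with two lists \<open>xs\<close>, \<open>ys\<close> of variables,
  jointly distinct and containing all variables of \<open>p\<close>. \<open>sat2 M p xs ys a b\<close> is the truth of
  \<open>p\<close> in \<open>M\<close> when \<open>xs\<close> is interpreted by the tuple \<open>a\<close> and \<open>ys\<close> by the tuple \<open>b\<close>.
\<close>

definition sat2 ::
  "('s, 'a) rel_structure \<Rightarrow> 's qf_formula \<Rightarrow> nat list \<Rightarrow> nat list \<Rightarrow> 'a list \<Rightarrow> 'a list \<Rightarrow> bool"
  where "sat2 M p xs ys a b \<longleftrightarrow> sat M (\<lambda>x. the (map_of (zip (xs @ ys) (a @ b)) x)) p"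

text \<open>Binary sequences are lists of booleans, with \<open>True\<close> for 1.\<close>

definition branching ::
  "('s, 'a) rel_structure \<Rightarrow> 's qf_formula \<Rightarrow> nat list \<Rightarrow> nat list \<Rightarrow> nat \<Rightarrow> bool" where
  "branching M p xs ys \<tau> \<longleftrightarrow>
    (\<exists>(a :: bool list \<Rightarrow> 'a list) (b :: bool list \<Rightarrow> 'a list).
      (\<forall>i. length i = \<tau> \<longrightarrow> length (a i) = length xs \<and> set (a i) \<subseteq> univ M) \<and>
      (\<forall>j. length j < \<tau> \<longrightarrow> length (b j) = length ys \<and> set (b j) \<subseteq> univ M) \<and>
      (\<forall>i j h. length i = \<tau> \<and> length j < \<tau> \<and> prefix (j @ [h]) i \<longrightarrow>
        (sat2 M p xs ys (a i) (b j) \<longleftrightarrow> h)))"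

definition min_branching ::
  "('s, 'a) rel_structure \<Rightarrow> 's qf_formula \<Rightarrow> nat list \<Rightarrow> nat list \<Rightarrow> nat \<Rightarrow> bool" where
  "min_branching F p xs ys \<tau> \<longleftrightarrow>
    branching F p xs ys \<tau> \<and> (\<forall>A. A \<subset> univ F \<longrightarrow> \<not> branching (induced F A) p xs ys \<tau>)"

text \<open>Embeddings are taken as extensional functions on \<open>univ F\<close>, so that they can be counted.\<close>

definition embeddings ::
  "'s set \<Rightarrow> ('s \<Rightarrow> nat) \<Rightarrow> ('s, 'b) rel_structure \<Rightarrow> ('s, 'a) rel_structure \<Rightarrow> ('b \<Rightarrow> 'a) set"
  where
  "embeddings L ar F N = {f \<in> univ F \<rightarrow>\<^sub>E univ N. inj_on f (univ F) \<and>
    (\<forall>E\<in>L. \<forall>t. length t = ar E \<and> set t \<subseteq> univ F \<longrightarrow> (t \<in> rel F E \<longleftrightarrow> map f t \<in> rel N E))}"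

text \<open>If \<open>F\<close> is larger than \<open>N\<close>, there are no embeddings and the value is \<open>0 / 0 = 0\<close>.\<close>

definition t_ind ::
  "'s set \<Rightarrow> ('s \<Rightarrow> nat) \<Rightarrow> ('s, 'b) rel_structure \<Rightarrow> ('s, 'a) rel_structure \<Rightarrow> real" where
  "t_ind L ar F N = real (card (embeddings L ar F N)) /
     (\<Prod>i<card (univ F). real (card (univ N)) - real i)"

text \<open>
  \<open>F\<close> ranges over structures on the same type as \<open>M\<close>. This loses no \<open>F\<close> up to isomorphism:
  as \<open>\<delta> > 0\<close>, the density bound makes \<open>F\<close> isomorphic to an induced substructure of \<open>M\<close>.
\<close>

definition dense_branching_for ::
  "'s set \<Rightarrow> ('s \<Rightarrow> nat) \<Rightarrow> ('s, 'a) rel_structure \<Rightarrow> real \<Rightarrow> nat \<Rightarrow>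
    's qf_formula \<Rightarrow> nat list \<Rightarrow> nat list \<Rightarrow> bool" where
  "dense_branching_for L ar M \<delta> \<tau> p xs ys \<longleftrightarrow>
    (\<exists>F :: ('s, 'a) rel_structure. is_structure L ar F \<and> finite (univ F) \<and>
       min_branching F p xs ys \<tau> \<and> t_ind L ar F M \<ge> \<delta>)"

definition dense_branching ::
  "'s set \<Rightarrow> ('s \<Rightarrow> nat) \<Rightarrow> ('s, 'a) rel_structure \<Rightarrow> real \<Rightarrow> nat \<Rightarrow> bool" where
  "dense_branching L ar M \<delta> \<tau> \<longleftrightarrow>
    (\<exists>E\<in>L. \<exists>j<ar E. dense_branching_for L ar M \<delta> \<tau>
       (Atom E [0..<ar E]) [j] (filter (\<lambda>x. x \<noteq> j) [0..<ar E]))"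

definition equitable :: "'a set set \<Rightarrow> bool" where
  "equitable P \<longleftrightarrow> (\<forall>p\<in>P. \<forall>q\<in>P. card p \<le> card q + 1)"

definition indivisible ::
  "'s set \<Rightarrow> ('s \<Rightarrow> nat) \<Rightarrow> ('s, 'a) rel_structure \<Rightarrow> 'a set set \<Rightarrow> bool" where
  "indivisible L ar N P \<longleftrightarrow>
    (\<forall>E\<in>L. \<forall>ps a0 a1. length ps = ar E \<and> set ps \<subseteq> P \<and>
       list_all2 (\<in>) a0 ps \<and> list_all2 (\<in>) a1 ps \<longrightarrow>
       (a0 \<in> rel N E \<longleftrightarrow> a1 \<in> rel N E))"

text \<open>For \<open>\<tau> = 0\<close> the product is 0, in line with the convention \<open>0 log 0 = 0\<close>.\<close>

definition g_exp :: "'s set \<Rightarrow> ('s \<Rightarrow> nat) \<Rightarrow> nat \<Rightarrow> int" where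
  "g_exp L ar \<tau> = \<lceil>5 * real (lang_size L ar) * real \<tau> * log 2 (real \<tau>)\<rceil>"

text \<open>
  A partition of a nonempty set has at least one part, so a bound \<open>(\<epsilon>/2) powi (- g - 2)\<close> on
  the number of parts is unsatisfiable if \<open>\<epsilon> > 2\<close>. Hence the theorem is stated for
  \<open>0 < \<epsilon> \<le> 2\<close>, the largest range in which it can hold.
\<close>

end

(*
  Fix a symbol E and a coordinate j, and view E as a relation R(x,y) between elements x and tuples y
  of the other coordinates. Call a set A good if for all but a fraction e of the y, the value R(x,y)
  is constant on A up to a fraction e. If A is large and has no large good subset, then splitting A
  repeatedly along the many y that witness badness yields a positive density of branching trees of
  height tau; by pigeonhole over the isomorphism types of minimal branching substructures this
  gives the (delta, tau)-branching property. Hence otherwise M is covered, up to a fraction e, by at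
  most e^(-tau) disjoint good sets (by M alone if tau <= 1), and R is close to a relation that
  depends on x only through its good set. Taking all pairs (E, j) together gives a partition into at
  most (e^(-tau) + 1)^(n_L) classes, which is made equitable at the cost of a few mixed parts.
  Averaging E over the boxes of the partition, one coordinate at a time, and rounding gives N.
*)
theory Submission
  imports Defs
begin

section \<open>Averaging over blocks\<close>

text \<open>For a fixed symbol, the good sets of different coordinates yield different
  approximations, each of them block-constant in one coordinate only, and these do not combine
  directly. Averaging combines them: it is linear, contracts the \<open>L^1\<close> norm and fixes
  functions that are constant along blocks, so every coordinate can be charged to its own
  approximation. With \<open>e = \<epsilon> / 16\<close>, good sets cost \<open>2 * e\<close>,
  uncovered elements \<open>e\<close> and mixed parts \<open>e\<close>, which makes
  \<open>\<epsilon> / 4\<close> per coordinate. Averaging and rounding each double this, and the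
  coordinates add up to \<open>ar E * \<epsilon>\<close>. All choices precede the structure: tree
  densities depend on \<open>e\<close> and \<open>\<tau>\<close>, the number of isomorphism types on
  \<open>\<tau>\<close> and the language. The exponent \<open>g\<close> pays for the covers only if
  \<open>\<tau> \<ge> 2\<close> and \<open>lang_size L ar \<ge> 1\<close>; otherwise it is 0 and a
  single part is used. A single part is also used for \<open>\<epsilon> \<ge> 1/2\<close>, where
  \<open>2 / \<epsilon>\<close> is too small for its powers to absorb the constants, but rounding a
  relation to the empty or the full one is close enough.\<close>

definition tuples :: "'a set \<Rightarrow> nat \<Rightarrow> 'a list set" where
  "tuples X k = {t. set t \<subseteq> X \<and> length t = k}"

lemma finite_tuples [simp]: "finite X \<Longrightarrow> finite (tuples X k)"
  by (simp add: tuples_def finite_lists_length_eq)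

lemma card_tuples: "finite X \<Longrightarrow> card (tuples X k) = card X ^ k"
  by (simp add: tuples_def card_lists_length_eq)

lemma tuples_length: "t \<in> tuples X k \<Longrightarrow> length t = k"
  by (simp add: tuples_def)

lemma tuples_nth: "t \<in> tuples X k \<Longrightarrow> j < k \<Longrightarrow> t ! j \<in> X"
  by (auto simp: tuples_def)

lemma tuples_update: "t \<in> tuples X k \<Longrightarrow> x \<in> X \<Longrightarrow> t[j := x] \<in> tuples X k"
  using set_update_subset_insert[of t j x] by (auto simp: tuples_def)

definition block :: "('a \<Rightarrow> 'b) \<Rightarrow> 'a set \<Rightarrow> 'a \<Rightarrow> 'a set" where
  "block h X x = {x' \<in> X. h x' = h x}"

text \<open>Conditional expectation of \<open>f\<close> when coordinate \<open>j\<close> is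
  resampled uniformly within its block.\<close>

definition avg :: "('a \<Rightarrow> 'b) \<Rightarrow> 'a set \<Rightarrow> nat \<Rightarrow> ('a list \<Rightarrow> real) \<Rightarrow> 'a list \<Rightarrow> real" where
  "avg h X j f t = (\<Sum>x\<in>block h X (t ! j). f (t[j := x])) / card (block h X (t ! j))"

lemma card_block_pos: "finite X \<Longrightarrow> x \<in> X \<Longrightarrow> 0 < card (block h X x)"
  unfolding block_def by (subst card_gt_0_iff) auto

lemma avg_diff: "avg h X j f t - avg h X j g t = avg h X j (\<lambda>t. f t - g t) t"
  by (simp add: avg_def sum_subtractf diff_divide_distrib)

text \<open>After the triangle inequality, exchanging the resampled entry \<open>x\<close> with
  \<open>t ! j\<close> is an involution on the pairs \<open>(t, x)\<close> that keeps the block size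
  in the denominator, so each \<open>\<bar>f t\<bar>\<close> is counted with total weight 1.\<close>

lemma avg_contraction:
  assumes "finite X" "j < k"
  shows "(\<Sum>t\<in>tuples X k. \<bar>avg h X j f t\<bar>) \<le> (\<Sum>t\<in>tuples X k. \<bar>f t\<bar>)"
proof -
  let ?c = "\<lambda>x. real (card (block h X x))"
  have blk: "block h X x = block h X y" if "x \<in> block h X y" for x y
    using that by (auto simp: block_def)
  have "(\<Sum>t\<in>tuples X k. \<bar>avg h X j f t\<bar>)
      \<le> (\<Sum>t\<in>tuples X k. \<Sum>x\<in>block h X (t ! j). \<bar>f (t[j := x])\<bar> / ?c (t ! j))"
    unfolding avg_def abs_divide
    by (intro sum_mono) (auto simp: sum_divide_distrib[symmetric] intro!: divide_right_mono sum_abs)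
  also have "\<dots> = (\<Sum>(t, x)\<in>Sigma (tuples X k) (\<lambda>t. block h X (t ! j)).
      \<bar>f (t[j := x])\<bar> / ?c (t ! j))"
    using assms by (subst sum.Sigma) (auto simp: block_def)
  also have "\<dots> = (\<Sum>(t, x)\<in>Sigma (tuples X k) (\<lambda>t. block h X (t ! j)). \<bar>f t\<bar> / ?c (t ! j))"
    using assms
    by (intro sum.reindex_bij_witness[where i = "\<lambda>(t, x). (t[j := x], t ! j)"
          and j = "\<lambda>(t, x). (t[j := x], t ! j)"])
      (auto simp: block_def tuples_update tuples_nth tuples_length)
  also have "\<dots> = (\<Sum>t\<in>tuples X k. \<Sum>x\<in>block h X (t ! j). \<bar>f t\<bar> / ?c (t ! j))"
    using assms by (subst sum.Sigma) (auto simp: block_def)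
  also have "\<dots> = (\<Sum>t\<in>tuples X k. \<bar>f t\<bar>)"
  proof (intro sum.cong refl)
    fix t assume "t \<in> tuples X k"
    then have "?c (t ! j) > 0" using card_block_pos assms tuples_nth by fastforce
    then show "(\<Sum>x\<in>block h X (t ! j). \<bar>f t\<bar> / ?c (t ! j)) = \<bar>f t\<bar>"
      by simp
  qed
  finally show ?thesis .
qed

primrec avgs :: "('a \<Rightarrow> 'b) \<Rightarrow> 'a set \<Rightarrow> nat \<Rightarrow> ('a list \<Rightarrow> real) \<Rightarrow> 'a list \<Rightarrow> real" where
  "avgs h X 0 f = f"
| "avgs h X (Suc j) f = avg h X j (avgs h X j f)"

text \<open>\<open>avgs h X (Suc j) f - f\<close> is the average of the preceding error plus
  \<open>avg h X j f - f\<close>. Contraction bounds the first term, so closeness is required only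
  for single averages of \<open>f\<close> itself, not for averages of averages.\<close>

lemma avgs_close:
  assumes "finite X" "j \<le> k"
    and close: "\<And>i. i < k \<Longrightarrow> (\<Sum>t\<in>tuples X k. \<bar>avg h X i f t - f t\<bar>) \<le> \<theta>"
  shows "(\<Sum>t\<in>tuples X k. \<bar>avgs h X j f t - f t\<bar>) \<le> j * \<theta>"
  using \<open>j \<le> k\<close>
proof (induction j)
  case (Suc j)
  have "(\<Sum>t\<in>tuples X k. \<bar>avgs h X (Suc j) f t - f t\<bar>)
      \<le> (\<Sum>t\<in>tuples X k. \<bar>avg h X j (\<lambda>t. avgs h X j f t - f t) t\<bar> + \<bar>avg h X j f t - f t\<bar>)"
    by (intro sum_mono) (simp add: avg_diff[symmetric])
  also have "\<dots> \<le> j * \<theta> + \<theta>"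
    unfolding sum.distrib
    using Suc avg_contraction[of X j k h "\<lambda>t. avgs h X j f t - f t"] close[of j] assms
    by (intro add_mono) auto
  finally show ?case by (simp add: algebra_simps)
qed simp

text \<open>Coordinates from \<open>j\<close> on have not been averaged yet, so there the tuples
  have to coincide; for \<open>j = k\<close> only the blocks of the entries matter. In the induction
  both tuples receive the same entry \<open>x\<close> at position \<open>j\<close>.\<close>

lemma avgs_eq:
  assumes "t \<in> tuples X k" "t' \<in> tuples X k" "map h t = map h t'" "j \<le> k"
    and "\<And>i. j \<le> i \<Longrightarrow> i < k \<Longrightarrow> t ! i = t' ! i"
  shows "avgs h X j f t = avgs h X j f t'"
  using assms
proof (induction j arbitrary: t t')
  case 0
  then have "t = t'" by (intro nth_equalityI) (auto simp: tuples_length)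
  then show ?case by simp
next
  case (Suc j)
  have "h (t ! j) = h (t' ! j)"
    using Suc.prems by (metis Suc_le_lessD nth_map tuples_length)
  then have "block h X (t ! j) = block h X (t' ! j)"
    by (simp add: block_def)
  moreover have "avgs h X j f (t[j := x]) = avgs h X j f (t'[j := x])" if "x \<in> X" for x
    using Suc.prems that
    by (intro Suc.IH) (auto simp: tuples_update map_update nth_list_update tuples_length)
  ultimately show ?case by (auto simp: avg_def block_def intro!: sum.cong arg_cong2[of _ _ _ _ "(/)"])
qed

text \<open>Averaging fixes \<open>g\<close>. Hence the average of \<open>f\<close> minus
  \<open>f\<close> equals the average of \<open>f - g\<close> minus \<open>f - g\<close>, and both
  of these have norm at most \<open>\<theta>\<close>.\<close>

lemma avg_close_of_invariant:
  assumes fin: "finite X" and "j < k" and R: "R \<subseteq> tuples X k"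
    and inv: "\<And>t x. t \<in> tuples X k \<Longrightarrow> x \<in> X \<Longrightarrow> h x = h (t ! j) \<Longrightarrow> g (t[j := x]) = g t"
    and close: "real (card {t \<in> tuples X k. (t \<in> R) \<noteq> g t}) \<le> \<theta>"
  shows "(\<Sum>t\<in>tuples X k. \<bar>avg h X j (\<lambda>t. of_bool (t \<in> R)) t - of_bool (t \<in> R)\<bar>) \<le> 2 * \<theta>"
proof -
  let ?f = "\<lambda>t. of_bool (t \<in> R) :: real" and ?g = "\<lambda>t. of_bool (g t) :: real"
  have "(\<Sum>t\<in>tuples X k. \<bar>?f t - ?g t\<bar>) = (\<Sum>t\<in>tuples X k. of_bool ((t \<in> R) \<noteq> g t))"
    by (intro sum.cong) auto
  also have "\<dots> = card {t \<in> tuples X k. (t \<in> R) \<noteq> g t}"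
    using fin by (simp add: Int_def)
  finally have d: "(\<Sum>t\<in>tuples X k. \<bar>?f t - ?g t\<bar>) \<le> \<theta>" using close by simp
  have eq: "avg h X j ?g t = ?g t" if t: "t \<in> tuples X k" for t
  proof -
    have "(\<Sum>x\<in>block h X (t ! j). ?g (t[j := x])) = (\<Sum>x\<in>block h X (t ! j). ?g t)"
      using inv t by (intro sum.cong) (auto simp: block_def)
    then show ?thesis
      using card_block_pos[OF fin, of "t ! j" h] tuples_nth[OF t \<open>j < k\<close>] by (simp add: avg_def)
  qed
  have "(\<Sum>t\<in>tuples X k. \<bar>avg h X j ?f t - ?f t\<bar>)
      \<le> (\<Sum>t\<in>tuples X k. \<bar>avg h X j (\<lambda>t. ?f t - ?g t) t\<bar> + \<bar>?f t - ?g t\<bar>)"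
  proof (rule sum_mono)
    fix t assume "t \<in> tuples X k"
    then have "avg h X j ?f t - ?f t = avg h X j (\<lambda>t. ?f t - ?g t) t - (?f t - ?g t)"
      using eq[of t] by (simp add: avg_diff[symmetric])
    then show "\<bar>avg h X j ?f t - ?f t\<bar> \<le> \<bar>avg h X j (\<lambda>t. ?f t - ?g t) t\<bar> + \<bar>?f t - ?g t\<bar>"
      by linarith
  qed
  also have "\<dots> \<le> \<theta> + \<theta>"
    unfolding sum.distrib
    using d avg_contraction[OF fin \<open>j < k\<close>, of h "\<lambda>t. ?f t - ?g t"] by (intro add_mono) linarith+
  finally show ?thesis by simp
qed

text \<open>
  Each averaging step is an \<open>L\<^sup>1\<close>-contraction, so the errors of the single coordinates add up.
\<close>

lemma box_constant_approximation:
  fixes h :: "'a \<Rightarrow> 'b"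
  assumes fin: "finite X" and R: "R \<subseteq> tuples X k"
    and inv: "\<And>j t x. j < k \<Longrightarrow> t \<in> tuples X k \<Longrightarrow> x \<in> X \<Longrightarrow> h x = h (t ! j) \<Longrightarrow>
      g j (t[j := x]) = g j t"
    and close: "\<And>j. j < k \<Longrightarrow> real (card {t \<in> tuples X k. (t \<in> R) \<noteq> g j t}) \<le> \<theta>"
  obtains R' where "R' \<subseteq> tuples X k"
    and "\<And>t t'. t \<in> tuples X k \<Longrightarrow> t' \<in> tuples X k \<Longrightarrow> map h t = map h t' \<Longrightarrow> t \<in> R' \<longleftrightarrow> t' \<in> R'"
    and "real (card (sym_diff R R')) \<le> 4 * real k * \<theta>"
proof
  let ?f = "\<lambda>t. of_bool (t \<in> R) :: real"
  let ?F = "avgs h X k ?f"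
  let ?R' = "{t \<in> tuples X k. ?F t > 1 / 2}"
  show "?R' \<subseteq> tuples X k" by auto
  show "t \<in> ?R' \<longleftrightarrow> t' \<in> ?R'"
    if "t \<in> tuples X k" "t' \<in> tuples X k" "map h t = map h t'" for t t'
    using avgs_eq[of t X k t' h k ?f] that by simp
  have sub: "sym_diff R ?R' \<subseteq> tuples X k" using R by auto
  have near: "(\<Sum>t\<in>tuples X k. \<bar>avg h X j ?f t - ?f t\<bar>) \<le> 2 * \<theta>" if "j < k" for j
    using that by (intro avg_close_of_invariant[OF fin _ R inv close])
  have "card (sym_diff R ?R') = (\<Sum>t\<in>sym_diff R ?R'. 1 :: real)" by simp
  \<comment> \<open>Rounding at 1/2: where \<open>R\<close> and \<open>?R'\<close> differ,
    \<open>?F t\<close> is at distance at least 1/2 from the value 0 or 1 of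
    \<open>?f t\<close>.\<close>
  also have "\<dots> \<le> (\<Sum>t\<in>sym_diff R ?R'. 2 * \<bar>?F t - ?f t\<bar>)"
    using R by (intro sum_mono) auto
  also have "\<dots> \<le> (\<Sum>t\<in>tuples X k. 2 * \<bar>?F t - ?f t\<bar>)"
    using sub fin by (intro sum_mono2) auto
  also have "\<dots> \<le> 2 * (k * (2 * \<theta>))"
    unfolding sum_distrib_left[symmetric]
    using avgs_close[OF fin order_refl near] by (simp add: algebra_simps)
  finally show "real (card (sym_diff R ?R')) \<le> 4 * real k * \<theta>" by simp
qed

section \<open>Equitable labellings\<close>

text \<open>The indices with label \<open>b\<close> form the interval from the ceiling of
  \<open>b * n / m\<close> up to, but excluding, the ceiling of \<open>(b + 1) * n / m\<close>. Its
  length is \<open>n div m\<close> plus a carry of remainders that is 0 or 1.\<close>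

lemma equitable_blocks_nat:
  fixes n m :: nat
  assumes "0 < m" "b < m" "0 < n"
  shows "card {p \<in> {..<n}. p * m div n = b} \<in> {n div m, n div m + 1}"
proof -
  \<comment> \<open>\<open>(y + m - 1) div m\<close> is the ceiling of \<open>y / m\<close>.\<close>
  have ceil: "y \<le> p * m \<longleftrightarrow> (y + m - 1) div m \<le> p" for y p
  proof -
    have "(y + m - 1) div m < Suc p \<longleftrightarrow> y + m - 1 < Suc p * m"
      using \<open>0 < m\<close> by (rule div_less_iff_less_mult)
    then show ?thesis using \<open>0 < m\<close> by auto
  qed
  have eq: "p < n \<and> p * m div n = b \<longleftrightarrow> b * n \<le> p * m \<and> \<not> b * n + n \<le> p * m" for p
  proof -
    have "p * m div n = b \<longleftrightarrow> b * n \<le> p * m \<and> p * m < Suc b * n"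
      using less_eq_div_iff_mult_less_eq[OF \<open>0 < n\<close>, of b "p * m"]
        div_less_iff_less_mult[OF \<open>0 < n\<close>, of "p * m" "Suc b"] by linarith
    moreover have "p < n" if "p * m < Suc b * n"
    proof -
      have "p * m < m * n" using that \<open>b < m\<close> by (meson Suc_leI less_le_trans mult_le_mono1)
      then show ?thesis using \<open>0 < m\<close> by simp
    qed
    ultimately show ?thesis by auto
  qed
  have "{p \<in> {..<n}. p * m div n = b} = {p. b * n \<le> p * m \<and> \<not> b * n + n \<le> p * m}"
    using eq by blast
  also have "\<dots> = {(b * n + m - 1) div m ..< (b * n + n + m - 1) div m}"
    unfolding ceil by (auto simp only: atLeastLessThan_iff not_le)
  finally have "card {p \<in> {..<n}. p * m div n = b}
      = (b * n + n + m - 1) div m - (b * n + m - 1) div m"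
    by simp
  moreover have "(b * n + n + m - 1) div m = (b * n + m - 1) div m + n div m
      + ((b * n + m - 1) mod m + n mod m) div m"
    using div_add1_eq[of "b * n + m - 1" n m] \<open>0 < m\<close> by (simp add: algebra_simps)
  moreover have "((b * n + m - 1) mod m + n mod m) div m < 2"
    using \<open>0 < m\<close> by (subst div_less_iff_less_mult) (auto intro: add_less_mono simp: mult_2)
  ultimately show ?thesis by auto
qed

text \<open>
  List \<open>X\<close> with the classes of \<open>C\<close> consecutive and cut the list into \<open>m\<close> intervals:
  every interval that is not contained in a class contains the end of one.
\<close>

lemma equitable_labelling:
  fixes C :: "'a \<Rightarrow> 'c"
  assumes fin: "finite X" and "X \<noteq> {}" and "0 < m" and K: "card (C ` X) \<le> K"
  obtains h :: "'a \<Rightarrow> nat" where "h ` X \<subseteq> {..<m}"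
    and "\<And>b. b < m \<Longrightarrow> card {x \<in> X. h x = b} \<in> {card X div m, card X div m + 1}"
    and "card {x \<in> X. \<exists>x'\<in>X. h x' = h x \<and> C x' \<noteq> C x} \<le> K * (card X div m + 1)"
proof -
  define n where "n = card X"
  have n: "0 < n" using assms by (simp add: n_def card_gt_0_iff)
  \<comment> \<open>Any numbering of the classes serves; it is the sort key that makes them
    consecutive.\<close>
  obtain \<iota> :: "'c \<Rightarrow> nat" where \<iota>: "inj_on \<iota> (C ` X)"
    using finite_imp_inj_to_nat_seg[of "C ` X"] fin by auto
  define \<kappa> where "\<kappa> x = \<iota> (C x)" for x
  have \<kappa>: "\<kappa> x = \<kappa> y \<longleftrightarrow> C x = C y" if "x \<in> X" "y \<in> X" for x y
    using \<iota> that by (auto simp: \<kappa>_def inj_on_def)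
  obtain xs0 where "set xs0 = X" "distinct xs0" using finite_distinct_list[OF fin] by auto
  define xs where "xs = sort_key \<kappa> xs0"
  have xs: "set xs = X" "distinct xs" "sorted (map \<kappa> xs)" "length xs = n"
    using \<open>set xs0 = X\<close> \<open>distinct xs0\<close> by (auto simp: xs_def n_def distinct_card)
  have bij: "bij_betw (\<lambda>p. xs ! p) {..<n} X"
    using bij_betw_nth[OF xs(2), of "{..<n}" X] xs by (simp add: lessThan_def)
  define pos where "pos = the_inv_into {..<n} (\<lambda>p. xs ! p)"
  have pos: "pos (xs ! p) = p" if "p < n" for p
    using that bij by (simp add: pos_def the_inv_into_f_f bij_betw_def)
  define h where "h x = pos x * m div n" for x
  have X: "x \<in> X \<longleftrightarrow> (\<exists>p<n. x = xs ! p)" for x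
    using xs by (metis in_set_conv_nth)
  have hx: "h (xs ! p) = p * m div n" if "p < n" for p
    using that by (simp add: h_def pos)
  have hm: "h ` X \<subseteq> {..<m}"
  proof
    fix b assume "b \<in> h ` X"
    then obtain p where "p < n" "b = p * m div n" using X hx by auto
    then show "b \<in> {..<m}"
      using n \<open>0 < m\<close> by (simp add: div_less_iff_less_mult mult.commute[of m])
  qed
  have size: "card {x \<in> X. h x = b} \<in> {n div m, n div m + 1}" if "b < m" for b
  proof -
    have "{x \<in> X. h x = b} = (\<lambda>p. xs ! p) ` {p \<in> {..<n}. p * m div n = b}"
      using X hx by auto
    moreover have "inj_on (\<lambda>p. xs ! p) {p \<in> {..<n}. p * m div n = b}"
      using bij by (auto simp: bij_betw_def inj_on_def)
    ultimately have "card {x \<in> X. h x = b} = card {p \<in> {..<n}. p * m div n = b}"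
      by (simp add: card_image)
    then show ?thesis using equitable_blocks_nat[OF \<open>0 < m\<close> that n] by simp
  qed
  let ?mixed = "\<lambda>b p p'. p < p' \<and> p' < n \<and> p * m div n = b \<and> p' * m div n = b \<and>
    \<kappa> (xs ! p) < \<kappa> (xs ! p')"
  \<comment> \<open>The labels whose interval meets two classes. For \<open>b < b'\<close> in
    \<open>B\<close> the key increases strictly from \<open>lo b\<close> to \<open>hi b\<close> and
    weakly on to \<open>lo b'\<close>, so the classes at the positions \<open>lo b\<close> are
    pairwise distinct and \<open>B\<close> is no larger than the set of classes.\<close>
  define B where "B = {b. \<exists>p p'. ?mixed b p p'}"
  have "\<forall>b\<in>B. \<exists>q. ?mixed b (fst q) (snd q)"
    by (auto simp: B_def)
  then obtain e where "\<forall>b\<in>B. ?mixed b (fst (e b)) (snd (e b))"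
    by (rule bchoice[THEN exE])
  then obtain lo hi where lohi: "\<And>b. b \<in> B \<Longrightarrow> ?mixed b (lo b) (hi b)"
    using that[of "fst \<circ> e" "snd \<circ> e"] by simp
  have mono: "\<kappa> (xs ! p) \<le> \<kappa> (xs ! p')" if "p \<le> p'" "p' < n" for p p'
    using sorted_nth_mono[OF xs(3), of p p'] that xs(4) by simp
  have lt: "\<kappa> (xs ! lo b) < \<kappa> (xs ! lo b')" if "b \<in> B" "b' \<in> B" "b < b'" for b b'
  proof -
    have "hi b < lo b'"
    proof (rule ccontr)
      assume "\<not> hi b < lo b'"
      then have "lo b' * m div n \<le> hi b * m div n" by (intro div_le_mono) simp
      then show False using lohi that by fastforce
    qed
    then show ?thesis using mono[of "hi b" "lo b'"] lohi[OF that(1)] lohi[OF that(2)] by linarith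
  qed
  have "inj_on (\<lambda>b. C (xs ! lo b)) B"
  proof (rule linorder_inj_onI')
    fix b b' assume "b \<in> B" "b' \<in> B" "b < b'"
    then show "C (xs ! lo b) \<noteq> C (xs ! lo b')"
      using lt[of b b'] by (auto simp: \<kappa>_def)
  qed
  moreover have "(\<lambda>b. C (xs ! lo b)) ` B \<subseteq> C ` X"
  proof
    fix c assume "c \<in> (\<lambda>b. C (xs ! lo b)) ` B"
    then obtain b where "b \<in> B" "c = C (xs ! lo b)" by auto
    moreover from this(1) have "lo b < n" using lohi[of b] by linarith
    ultimately show "c \<in> C ` X" using X by auto
  qed
  ultimately have cB: "card B \<le> K" "finite B"
    using K card_inj_on_le[of "\<lambda>b. C (xs ! lo b)" B "C ` X"] inj_on_finite[of _ B "C ` X"] fin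
    by (auto intro: le_trans)
  have Bm: "b < m" if "b \<in> B" for b
  proof -
    have "lo b < n" "lo b * m div n = b" using lohi[OF that] by linarith+
    then have "b \<in> h ` X" using hx[of "lo b"] X by force
    then show ?thesis using hm by auto
  qed
  have "{x \<in> X. \<exists>x'\<in>X. h x' = h x \<and> C x' \<noteq> C x} \<subseteq> (\<Union>b\<in>B. {x \<in> X. h x = b})"
  proof safe
    fix x x' assume "x \<in> X" "x' \<in> X" and eq: "h x' = h x" and ne: "C x' \<noteq> C x"
    then obtain p p' where p: "p < n" "x = xs ! p" "p' < n" "x' = xs ! p'" using X by auto
    have k: "\<kappa> x \<noteq> \<kappa> x'" using \<kappa> \<open>x \<in> X\<close> \<open>x' \<in> X\<close> ne by auto
    then have "p \<noteq> p'" using p by auto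
    then have "h x \<in> B"
    proof (cases "p < p'")
      case True
      then have "?mixed (h x) p p'" using p eq k hx mono[of p p'] by auto
      then show ?thesis unfolding B_def by blast
    next
      case False
      then have "?mixed (h x) p' p" using p eq k hx mono[of p' p] \<open>p \<noteq> p'\<close> by auto
      then show ?thesis unfolding B_def by blast
    qed
    then show "x \<in> (\<Union>b\<in>B. {x \<in> X. h x = b})" using \<open>x \<in> X\<close> by auto
  qed
  then have "card {x \<in> X. \<exists>x'\<in>X. h x' = h x \<and> C x' \<noteq> C x} \<le> card (\<Union>b\<in>B. {x \<in> X. h x = b})"
    using fin cB by (intro card_mono) auto
  also have "\<dots> \<le> (\<Sum>b\<in>B. card {x \<in> X. h x = b})"
    using cB by (intro card_UN_le) auto
  also have "\<dots> \<le> (\<Sum>b\<in>B. n div m + 1)"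
  proof (rule sum_mono)
    fix b assume "b \<in> B"
    then show "card {x \<in> X. h x = b} \<le> n div m + 1" using size[OF Bm[OF \<open>b \<in> B\<close>]] by auto
  qed
  also have "\<dots> \<le> K * (n div m + 1)"
    unfolding sum_constant of_nat_id using cB(1) by (intro mult_le_mono1)
  finally show thesis
    using that[of h] hm size unfolding n_def by blast
qed

section \<open>Branching trees and good sets\<close>

definition good :: "('a \<Rightarrow> 'b \<Rightarrow> bool) \<Rightarrow> 'b set \<Rightarrow> real \<Rightarrow> 'a set \<Rightarrow> bool" where
  "good R Y e A \<longleftrightarrow> real (card {y \<in> Y. e * card A \<le> card {x \<in> A. R x y} \<and>
     e * card A \<le> card {x \<in> A. \<not> R x y}}) < e * card Y"

text \<open>
  A tree witnessing branching of height \<open>n\<close> with leaves in \<open>A\<close>, flattened to the list of all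
  elements that occur in it, so that the witnesses can be counted as tuples of a fixed length.
\<close>

primrec trees :: "('a \<Rightarrow> 'a list \<Rightarrow> bool) \<Rightarrow> 'a list set \<Rightarrow> nat \<Rightarrow> 'a set \<Rightarrow> 'a list set" where
  "trees R Y 0 A = (\<lambda>x. [x]) ` A"
| "trees R Y (Suc n) A = (\<lambda>(y, l, r). y @ l @ r) `
    (SIGMA y : Y. trees R Y n {x \<in> A. \<not> R x y} \<times> trees R Y n {x \<in> A. R x y})"

text \<open>In closed form \<open>2^n + q * (2^n - 1)\<close>: there are \<open>2^n\<close> leaves,
  and \<open>2^n - 1\<close> inner nodes that carry a tuple of length \<open>q\<close> each.\<close>

primrec tree_length :: "nat \<Rightarrow> nat \<Rightarrow> nat" where
  "tree_length q 0 = 1"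
| "tree_length q (Suc n) = q + 2 * tree_length q n"

text \<open>A lower bound for the density of trees of height \<open>n\<close> over a set of density
  \<open>a\<close> when no set met on the way is good: a fraction \<open>e\<close> of the roots is
  usable, and the two subtrees are chosen independently over sets of density at least
  \<open>e * a\<close>.\<close>

primrec tree_bound :: "real \<Rightarrow> nat \<Rightarrow> real \<Rightarrow> real" where
  "tree_bound e 0 a = a"
| "tree_bound e (Suc n) a = e * (tree_bound e n (e * a))\<^sup>2"

lemma tree_bound_pos: "0 < e \<Longrightarrow> 0 < a \<Longrightarrow> 0 < tree_bound e n a"
proof (induction n arbitrary: a)
  case (Suc n)
  then have "0 < tree_bound e n (e * a)" by simp
  then show ?case using Suc.prems by simp
qed simp

lemma trees_subset_tuples:
  "A \<subseteq> X \<Longrightarrow> trees R (tuples X q) n A \<subseteq> tuples X (tree_length q n)"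
proof (induction n arbitrary: A)
  case (Suc n)
  have "trees R (tuples X q) n {x \<in> A. P x} \<subseteq> tuples X (tree_length q n)" for P
    using Suc.prems by (intro Suc.IH) auto
  note sub = subsetD[OF this]
  show ?case
  proof
    fix t assume "t \<in> trees R (tuples X q) (Suc n) A"
    then obtain y l r where "t = y @ l @ r" "y \<in> tuples X q" and
      "l \<in> trees R (tuples X q) n {x \<in> A. \<not> R x y}" "r \<in> trees R (tuples X q) n {x \<in> A. R x y}"
      by auto
    with sub[OF this(3)] sub[OF this(4)] show "t \<in> tuples X (tree_length q (Suc n))"
      by (simp add: tuples_def)
  qed
qed (auto simp: tuples_def)

lemma trees_mono: "A \<subseteq> B \<Longrightarrow> trees R Y n A \<subseteq> trees R Y n B"
proof (induction n arbitrary: A B)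
  case (Suc n)
  have "trees R Y n {x \<in> A. P x} \<subseteq> trees R Y n {x \<in> B. P x}" for P
    using Suc.prems by (intro Suc.IH) auto
  then show ?case unfolding trees.simps by (intro image_mono Sigma_mono order_refl) auto
qed auto

lemma finite_trees: "finite X \<Longrightarrow> A \<subseteq> X \<Longrightarrow> finite (trees R (tuples X q) n A)"
  by (rule finite_subset[OF trees_subset_tuples finite_tuples])

text \<open>All trees of one height have the same length, so the concatenation can be decoded
  uniquely and the numbers of left and right subtrees multiply.\<close>

lemma card_trees_Suc:
  assumes "finite X" "A \<subseteq> X"
  shows "card (trees R (tuples X q) (Suc n) A) = (\<Sum>y\<in>tuples X q.
    card (trees R (tuples X q) n {x \<in> A. \<not> R x y}) * card (trees R (tuples X q) n {x \<in> A. R x y}))"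
proof -
  have sub: "trees R (tuples X q) n {x \<in> A. P x} \<subseteq> tuples X (tree_length q n)" for P
    using assms by (intro trees_subset_tuples) auto
  have "inj_on (\<lambda>(y, l, r). y @ l @ r) (SIGMA y : tuples X q.
      trees R (tuples X q) n {x \<in> A. \<not> R x y} \<times> trees R (tuples X q) n {x \<in> A. R x y})"
  proof (rule inj_onI, clarsimp)
    fix y l r y' l' r'
    assume *: "y \<in> tuples X q" "y' \<in> tuples X q"
      "l \<in> trees R (tuples X q) n {x \<in> A. \<not> R x y}" "l' \<in> trees R (tuples X q) n {x \<in> A. \<not> R x y'}"
      "y @ l @ r = y' @ l' @ r'"
    then have "length y = length y'" by (simp add: tuples_length)
    moreover have "l \<in> tuples X (tree_length q n)" "l' \<in> tuples X (tree_length q n)"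
      using *(3,4) sub[of "\<lambda>x. \<not> R x y"] sub[of "\<lambda>x. \<not> R x y'"] by auto
    then have "length l = length l'" by (simp add: tuples_length)
    ultimately show "y = y' \<and> l = l' \<and> r = r'" using * by simp
  qed
  then have "card (trees R (tuples X q) (Suc n) A) = card (SIGMA y : tuples X q.
      trees R (tuples X q) n {x \<in> A. \<not> R x y} \<times> trees R (tuples X q) n {x \<in> A. R x y})"
    unfolding trees.simps by (rule card_image)
  also have "\<dots> = (\<Sum>y\<in>tuples X q. card (trees R (tuples X q) n {x \<in> A. \<not> R x y} \<times>
      trees R (tuples X q) n {x \<in> A. R x y}))"
  proof (rule card_SigmaI)
    have "finite (trees R (tuples X q) n {x \<in> A. P x})" for P
      using assms by (intro finite_trees) auto
    then show "\<forall>y\<in>tuples X q. finite (trees R (tuples X q) n {x \<in> A. \<not> R x y} \<times>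
        trees R (tuples X q) n {x \<in> A. R x y})" by simp
  qed (simp add: assms)
  finally show ?thesis by (simp add: card_cartesian_product)
qed

text \<open>If \<open>A\<close> is not good, at least a fraction \<open>e\<close> of the roots leave
  a fraction \<open>e\<close> of \<open>A\<close> on both sides, and the argument continues on each
  side. For \<open>n > 0\<close> the condition \<open>b * e \<le> a * e ^ n\<close> says that
  \<open>a * e ^ (n - 1)\<close>, the lower bound for the density of the last sets to be split, is
  at least \<open>b\<close>; the sets at the leaves are not split again.\<close>

lemma many_trees:
  fixes a b e :: real
  assumes fin: "finite X" and e: "0 < e" "e \<le> 1"
    and "B \<subseteq> X" and not_good: "\<And>A. A \<subseteq> B \<Longrightarrow> b * card X \<le> card A \<Longrightarrow> \<not> good R (tuples X q) e A"
  shows "A \<subseteq> B \<Longrightarrow> 0 < a \<Longrightarrow> a * card X \<le> card A \<Longrightarrow> b * e \<le> a * e ^ n \<Longrightarrow>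
    tree_bound e n a * real (card X) ^ tree_length q n \<le> card (trees R (tuples X q) n A)"
proof (induction n arbitrary: A a)
  case 0
  then show ?case by (simp add: card_image inj_on_def)
next
  case (Suc n)
  let ?Y = "tuples X q" and ?N = "real (card X)"
  let ?A = "\<lambda>h y. {x \<in> A. R x y = h}"
  let ?c = "\<lambda>h y. real (card (trees R ?Y n (?A h y)))"
  define Z where "Z = {y \<in> ?Y. e * card A \<le> card (?A True y) \<and> e * card A \<le> card (?A False y)}"
  let ?u = "tree_bound e n (e * a) * ?N ^ tree_length q n"
  have "b * e \<le> a * e ^ n * e" using Suc.prems by (simp add: mult_ac)
  then have "b \<le> a * e ^ n" using e by simp
  also have "\<dots> \<le> a" using e Suc.prems by (simp add: mult_left_le power_le_one)
  finally have "b * ?N \<le> a * ?N" by (rule mult_right_mono) simp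
  then have "b * ?N \<le> card A" using Suc.prems by linarith
  then have "\<not> good R ?Y e A" using not_good Suc.prems by blast
  then have Z: "e * ?N ^ q \<le> card Z"
    by (simp add: good_def Z_def card_tuples[OF fin])
  have u: "?u \<le> ?c h y" if "y \<in> Z" for h y
  proof (rule Suc.IH)
    show "?A h y \<subseteq> B" using Suc.prems(1) by auto
    have "e * (a * ?N) \<le> e * card A" using Suc.prems e by (intro mult_left_mono) auto
    also have "\<dots> \<le> card (?A h y)" using that by (cases h) (auto simp: Z_def)
    finally show "e * a * ?N \<le> card (?A h y)" by (simp add: mult_ac)
  qed (use Suc.prems e in \<open>auto simp: mult_ac\<close>)
  have u0: "0 \<le> ?u" using tree_bound_pos[of e "e * a" n] e Suc.prems by simp
  have "tree_bound e (Suc n) a * ?N ^ tree_length q (Suc n) = e * ?N ^ q * (?u * ?u)"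
    by (simp add: power_add power2_eq_square mult_ac power_mult power_mult_distrib)
  also have "\<dots> \<le> card Z * (?u * ?u)"
    using Z u0 by (intro mult_right_mono) auto
  also have "\<dots> = (\<Sum>y\<in>Z. ?u * ?u)" by simp
  also have "\<dots> \<le> (\<Sum>y\<in>Z. ?c False y * ?c True y)"
    using u[of _ False] u[of _ True] u0 by (intro sum_mono mult_mono) simp_all
  also have "\<dots> \<le> (\<Sum>y\<in>?Y. ?c False y * ?c True y)"
    using fin by (intro sum_mono2) (auto simp: Z_def)
  also have "\<dots> = card (trees R ?Y (Suc n) A)"
    using card_trees_Suc[OF fin subset_trans[OF Suc.prems(1) \<open>B \<subseteq> X\<close>], of R q n] by simp
  finally show ?case .
qed

text \<open>The root tuple belongs to the empty sequence and the first bit selects the subtree: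
  \<open>l\<close> has its leaves where \<open>R _ y\<close> fails, \<open>r\<close> where it holds.
  Membership in \<open>set t\<close> is carried along so that the witnesses lie in the substructure
  on the entries of \<open>t\<close>.\<close>

lemma trees_branching:
  "t \<in> trees R Y n A \<Longrightarrow> \<exists>a b.
    (\<forall>i. length i = n \<longrightarrow> a i \<in> A \<and> a i \<in> set t) \<and>
    (\<forall>j. length j < n \<longrightarrow> b j \<in> Y \<and> set (b j) \<subseteq> set t) \<and>
    (\<forall>i j h. length i = n \<and> length j < n \<and> prefix (j @ [h]) i \<longrightarrow> (R (a i) (b j) \<longleftrightarrow> h))"
proof (induction n arbitrary: A t)
  case 0
  then obtain x where "x \<in> A" "t = [x]" by auto
  then show ?case by (intro exI[of _ "\<lambda>_. x"] exI[of _ "\<lambda>_. []"]) auto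
next
  case (Suc n)
  then obtain y l r where t: "y \<in> Y" "t = y @ l @ r" and
    lr: "l \<in> trees R Y n {x \<in> A. \<not> R x y}" "r \<in> trees R Y n {x \<in> A. R x y}" by auto
  obtain a0 b0 where 0: "\<forall>i. length i = n \<longrightarrow> a0 i \<in> {x \<in> A. \<not> R x y} \<and> a0 i \<in> set l"
    "\<forall>j. length j < n \<longrightarrow> b0 j \<in> Y \<and> set (b0 j) \<subseteq> set l"
    "\<forall>i j h. length i = n \<and> length j < n \<and> prefix (j @ [h]) i \<longrightarrow> (R (a0 i) (b0 j) \<longleftrightarrow> h)"
    using Suc.IH[OF lr(1)] by blast
  obtain a1 b1 where 1: "\<forall>i. length i = n \<longrightarrow> a1 i \<in> {x \<in> A. R x y} \<and> a1 i \<in> set r"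
    "\<forall>j. length j < n \<longrightarrow> b1 j \<in> Y \<and> set (b1 j) \<subseteq> set r"
    "\<forall>i j h. length i = n \<and> length j < n \<and> prefix (j @ [h]) i \<longrightarrow> (R (a1 i) (b1 j) \<longleftrightarrow> h)"
    using Suc.IH[OF lr(2)] by blast
  let ?a = "\<lambda>i. if hd i then a1 (tl i) else a0 (tl i)"
  let ?b = "\<lambda>j. if j = [] then y else if hd j then b1 (tl j) else b0 (tl j)"
  have "?a i \<in> A \<and> ?a i \<in> set t" if "length i = Suc n" for i
    using that 0(1) 1(1) t by (cases i) auto
  moreover have "?b j \<in> Y \<and> set (?b j) \<subseteq> set t" if "length j < Suc n" for j
    using that 0(2) 1(2) t by (cases j) auto
  moreover have "R (?a i) (?b j) \<longleftrightarrow> h"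
    if "length i = Suc n \<and> length j < Suc n \<and> prefix (j @ [h]) i" for i j h
  proof -
    have "i \<noteq> []" using that by auto
    then obtain h' i' where i: "i = h' # i'" by (cases i) auto
    show ?thesis
    proof (cases j)
      case Nil
      then show ?thesis using that 0(1) 1(1) i by auto
    next
      case (Cons g j')
      then show ?thesis using that 0(3) 1(3) i by auto
    qed
  qed
  ultimately show ?case by (intro exI[of _ ?a] exI[of _ ?b]) blast
qed

section \<open>Disjoint covers and the majority approximation\<close>

lemma greedy_cover:
  fixes A :: "'a set" and c s :: real
  assumes fin: "finite A" and c: "0 < c" and "0 < s"
    and step: "\<And>B. B \<subseteq> A \<Longrightarrow> s \<le> card B \<Longrightarrow> \<exists>B'\<subseteq>B. P B' \<and> c \<le> card B'"
  shows "\<exists>\<A>. disjoint \<A> \<and> \<Union>\<A> \<subseteq> A \<and> (\<forall>B\<in>\<A>. P B \<and> c \<le> card B) \<and> real (card (A - \<Union>\<A>)) \<le> s"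
  using fin step
proof (induction A rule: finite_psubset_induct)
  case (psubset A)
  show ?case
  proof (cases "s \<le> card A")
    case False
    then show ?thesis by (intro exI[of _ "{}"]) auto
  next
    case True
    then obtain B where B: "B \<subseteq> A" "P B" "c \<le> card B" using psubset.prems by blast
    \<comment> \<open>As \<open>0 < c\<close>, the removed set is nonempty and the induction passes
      to a proper subset; the step hypothesis is inherited because it speaks of all subsets.\<close>
    then have "B \<noteq> {}" using c by auto
    then have "A - B \<subset> A" using B by auto
    moreover have "\<exists>B'\<subseteq>C. P B' \<and> c \<le> card B'" if "C \<subseteq> A - B" "s \<le> card C" for C
      using psubset.prems that by blast
    ultimately obtain \<A> where \<A>: "disjoint \<A>" "\<Union>\<A> \<subseteq> A - B" "\<forall>B\<in>\<A>. P B \<and> c \<le> card B"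
      "real (card (A - B - \<Union>\<A>)) \<le> s"
      using psubset.IH[of "A - B"] by blast
    have "A - \<Union>(insert B \<A>) = A - B - \<Union>\<A>" by auto
    moreover have "disjoint (insert B \<A>)"
      using \<A>(1,2) by (auto simp: disjoint_def)
    ultimately show ?thesis using \<A> B by (intro exI[of _ "insert B \<A>"]) auto
  qed
qed

lemma card_disjoint_family:
  assumes "finite X" "disjoint \<A>" "\<Union>\<A> \<subseteq> X" "\<forall>B\<in>\<A>. (c :: real) * card X \<le> card B" "X \<noteq> {}" "0 < c"
  shows "real (card \<A>) \<le> 1 / c"
proof -
  have fin: "finite \<A>" "\<And>B. B \<in> \<A> \<Longrightarrow> finite B"
    using assms finite_UnionD finite_subset by (blast, metis Sup_le_iff finite_subset)
  have "card \<A> * (c * card X) = (\<Sum>B\<in>\<A>. c * card X)" by simp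
  also have "\<dots> \<le> (\<Sum>B\<in>\<A>. real (card B))" using assms by (intro sum_mono) auto
  also have "\<dots> = card (\<Union>\<A>)"
    using card_Union_disjoint[of \<A>] assms(2) fin by (simp add: disjoint_def pairwise_def disjnt_def)
  also have "\<dots> \<le> card X" using assms by (intro of_nat_mono card_mono)
  finally have "(card \<A> * c) * card X \<le> 1 * card X" by (simp add: mult_ac)
  moreover have "0 < real (card X)" using assms by (simp add: card_gt_0_iff)
  ultimately have "card \<A> * c \<le> 1" by (simp only: mult_le_cancel_right_pos of_nat_mult of_nat_1)
  then show ?thesis using \<open>0 < c\<close> by (simp add: field_simps)
qed

definition majority :: "('a \<Rightarrow> 'b \<Rightarrow> bool) \<Rightarrow> 'a set \<Rightarrow> 'b \<Rightarrow> bool" where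
  "majority R A y \<longleftrightarrow> card {x \<in> A. \<not> R x y} < card {x \<in> A. R x y}"

text \<open>There are at most \<open>e * card Y\<close> exceptional \<open>y\<close>, each with at
  most \<open>card A\<close> errors; at any other \<open>y\<close> the minority has fewer than
  \<open>e * card A\<close> elements. Each of the two contributions gives one
  \<open>e\<close>.\<close>

lemma majority_error_good:
  assumes "finite A" "finite Y" "0 < e" and good: "good R Y e A"
  shows "real (card {(x, y) \<in> A \<times> Y. R x y \<noteq> majority R A y}) \<le> 2 * e * card A * card Y"
proof -
  let ?D = "\<lambda>y. {x \<in> A. R x y \<noteq> majority R A y}"
  define Z where "Z = {y \<in> Y. e * card A \<le> card {x \<in> A. R x y} \<and>
     e * card A \<le> card {x \<in> A. \<not> R x y}}"
  have Z: "real (card Z) \<le> e * card Y" "Z \<subseteq> Y" using good by (auto simp: good_def Z_def)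
  have "{(x, y) \<in> A \<times> Y. R x y \<noteq> majority R A y} = (\<lambda>(y, x). (x, y)) ` (SIGMA y : Y. ?D y)"
    by auto
  then have "real (card {(x, y) \<in> A \<times> Y. R x y \<noteq> majority R A y}) = (\<Sum>y\<in>Y. real (card (?D y)))"
    using assms by (simp add: card_image inj_on_def)
  also have "\<dots> \<le> (\<Sum>y\<in>Y. e * card A + of_bool (y \<in> Z) * card A)"
  proof (rule sum_mono)
    fix y assume "y \<in> Y"
    show "real (card (?D y)) \<le> e * card A + of_bool (y \<in> Z) * card A"
    proof (cases "y \<in> Z")
      case True
      have "card (?D y) \<le> card A" using assms by (intro card_mono) auto
      then show ?thesis using True \<open>0 < e\<close> by (simp add: add_increasing)
    next
      case False
      then have "card {x \<in> A. R x y} < e * card A \<or> card {x \<in> A. \<not> R x y} < e * card A"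
        using \<open>y \<in> Y\<close> by (auto simp: Z_def)
      moreover have "?D y = (if majority R A y then {x \<in> A. \<not> R x y} else {x \<in> A. R x y})"
        by auto
      moreover have "real (card {x \<in> A. \<not> R x y}) < card {x \<in> A. R x y} \<longleftrightarrow> majority R A y"
        by (simp add: majority_def)
      ultimately show ?thesis using False by (auto split: if_splits)
    qed
  qed
  also have "\<dots> = e * card A * card Y + card Z * card A"
    using Z(2) assms(2) by (simp add: sum.distrib sum_distrib_right[symmetric] Int_absorb1)
  also have "\<dots> \<le> e * card A * card Y + e * card Y * card A"
    using mult_right_mono[OF Z(1), of "real (card A)"] by (simp add: mult_ac)
  finally show ?thesis by (simp add: mult_ac)
qed

text \<open>For a disjoint family this is the member that contains \<open>x\<close>. Uncovered
  elements get \<open>{}\<close>, on which \<open>majority\<close> is constantly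
  \<open>False\<close>, so they need no separate treatment as a class.\<close>

definition label :: "'a set set \<Rightarrow> 'a \<Rightarrow> 'a set" where
  "label \<A> x = \<Union>{A \<in> \<A>. x \<in> A}"

lemma label_eq: "disjoint \<A> \<Longrightarrow> A \<in> \<A> \<Longrightarrow> x \<in> A \<Longrightarrow> label \<A> x = A"
proof -
  assume *: "disjoint \<A>" "A \<in> \<A>" "x \<in> A"
  then have "{A \<in> \<A>. x \<in> A} = {A}" by (auto dest: disjointD)
  then show ?thesis by (simp add: label_def)
qed

lemma label_image: "disjoint \<A> \<Longrightarrow> label \<A> ` X \<subseteq> insert {} \<A>"
proof clarify
  fix x assume *: "disjoint \<A>" "label \<A> x \<notin> \<A>"
  then show "label \<A> x = {}" using label_eq[OF *(1)] by (auto simp: label_def)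
qed

text \<open>Every pair with an uncovered element is counted as an error, at cost \<open>e\<close>;
  the members of the cover contribute \<open>2 * e\<close> of their own pairs.\<close>

lemma majority_error:
  assumes "finite X" "finite Y" "0 < e" and \<A>: "disjoint \<A>" "\<Union>\<A> \<subseteq> X" "\<forall>A\<in>\<A>. good R Y e A"
    and left: "real (card (X - \<Union>\<A>)) \<le> e * card X"
  shows "real (card {(x, y) \<in> X \<times> Y. R x y \<noteq> majority R (label \<A> x) y}) \<le> 3 * e * card X * card Y"
proof -
  let ?D = "\<lambda>A. {(x, y) \<in> A \<times> Y. R x y \<noteq> majority R A y}"
  have fin: "finite \<A>" "\<And>A. A \<in> \<A> \<Longrightarrow> finite A"
    using assms finite_UnionD finite_subset by (blast, metis Sup_le_iff finite_subset)
  have sub: "{(x, y) \<in> X \<times> Y. R x y \<noteq> majority R (label \<A> x) y}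
      \<subseteq> (X - \<Union>\<A>) \<times> Y \<union> (\<Union>A\<in>\<A>. ?D A)"
    using label_eq[OF \<A>(1)] by auto
  have "finite (?D A)" if "A \<in> \<A>" for A
  proof (rule finite_subset)
    show "?D A \<subseteq> A \<times> Y" by auto
  qed (use fin(2)[OF that] assms(2) in simp)
  then have finD: "finite (\<Union>A\<in>\<A>. ?D A)"
    using fin(1) by (rule finite_UN_I[rotated])
  have "card {(x, y) \<in> X \<times> Y. R x y \<noteq> majority R (label \<A> x) y}
      \<le> card ((X - \<Union>\<A>) \<times> Y \<union> (\<Union>A\<in>\<A>. ?D A))"
  proof (rule card_mono[OF _ sub])
    show "finite ((X - \<Union>\<A>) \<times> Y \<union> (\<Union>A\<in>\<A>. ?D A))"
      using assms(1,2) by (intro finite_UnI finD finite_cartesian_product finite_Diff)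
  qed
  also have "\<dots> \<le> card ((X - \<Union>\<A>) \<times> Y) + (\<Sum>A\<in>\<A>. card (?D A))"
    using card_UN_le[OF fin(1), of ?D] by (intro order_trans[OF card_Un_le] add_left_mono)
  finally have "real (card {(x, y) \<in> X \<times> Y. R x y \<noteq> majority R (label \<A> x) y})
      \<le> real (card ((X - \<Union>\<A>) \<times> Y) + (\<Sum>A\<in>\<A>. card (?D A)))"
    by (rule of_nat_mono)
  also have "\<dots> = real (card (X - \<Union>\<A>)) * card Y + (\<Sum>A\<in>\<A>. real (card (?D A)))"
    by (simp add: card_cartesian_product)
  also have "\<dots> \<le> e * card X * card Y + (\<Sum>A\<in>\<A>. 2 * e * card A * card Y)"
  proof (intro add_mono mult_right_mono[OF left] sum_mono)
    fix A assume "A \<in> \<A>"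
    then show "real (card (?D A)) \<le> 2 * e * card A * card Y"
      using fin(2) assms(2,3) \<A>(3) by (intro majority_error_good) blast+
  qed simp
  also have "(\<Sum>A\<in>\<A>. 2 * e * card A * card Y) = 2 * e * card (\<Union>\<A>) * card Y"
    using card_Union_disjoint[of \<A>] \<A>(1) fin
    by (simp add: disjoint_def pairwise_def disjnt_def sum_distrib_left sum_distrib_right)
  also have "\<dots> \<le> 2 * e * card X * card Y"
    using assms card_mono[OF assms(1) \<A>(2)] by (intro mult_right_mono mult_left_mono) auto
  finally show ?thesis by (simp add: algebra_simps)
qed

section \<open>Branching density\<close>

text \<open>The map from \<open>t\<close> to \<open>(t ! j, del j t)\<close>, with
  \<open>ins j\<close> as its inverse, turns a relation of arity \<open>k\<close> into a binary one
  between elements and tuples of length \<open>k - 1\<close>.\<close>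

definition ins :: "nat \<Rightarrow> 'a \<Rightarrow> 'a list \<Rightarrow> 'a list" where
  "ins j x y = take j y @ x # drop j y"

definition del :: "nat \<Rightarrow> 'a list \<Rightarrow> 'a list" where
  "del j t = take j t @ drop (Suc j) t"

lemma ins_del: "j < length t \<Longrightarrow> ins j (t ! j) (del j t) = t"
  by (simp add: ins_def del_def id_take_nth_drop[symmetric])

lemma del_update: "del j (t[j := x]) = del j t"
  by (simp add: del_def drop_update_cancel)

lemma set_ins: "set (ins j x y) = insert x (set y)"
  unfolding ins_def by (metis Un_insert_right append_take_drop_id list.simps(15) set_append)

lemma del_in_tuples: "t \<in> tuples X (Suc k) \<Longrightarrow> j \<le> k \<Longrightarrow> del j t \<in> tuples X k"
  using set_take_subset[of j t] set_drop_subset[of "Suc j" t] by (auto simp: tuples_def del_def)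

text \<open>The variables other than \<open>j\<close> are \<open>[0..<j] @ [Suc j..<k]\<close>, so
  variable \<open>i\<close> reads entry \<open>i\<close> of \<open>y\<close> to the left of
  \<open>j\<close> and entry \<open>i - 1\<close> to the right of it, which is what
  \<open>ins\<close> does.\<close>

lemma sat2_atom:
  assumes "j < k" "length y = k - 1"
  shows "sat2 M (Atom E [0..<k]) [j] (filter (\<lambda>x. x \<noteq> j) [0..<k]) [x] y \<longleftrightarrow> ins j x y \<in> rel M E"
proof -
  let ?ys = "filter (\<lambda>x. x \<noteq> j) [0..<k]"
  have "[0..<k] = [0..<j] @ [j..<k]"
    using upt_add_eq_append[of 0 j "k - j"] assms by simp
  also have "[j..<k] = j # [Suc j..<k]"
    using assms by (simp add: upt_conv_Cons)
  finally have split: "[0..<k] = [0..<j] @ j # [Suc j..<k]" .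
  have "filter (\<lambda>x. x \<noteq> j) [0..<j] = [0..<j]" "filter (\<lambda>x. x \<noteq> j) [Suc j..<k] = [Suc j..<k]"
    by (auto intro: filter_True)
  then have ys: "?ys = [0..<j] @ [Suc j..<k]"
    by (subst split) simp
  have ys_nth: "?ys ! i = (if i < j then i else Suc i)" and len: "length ?ys = k - 1" if "i < k - 1" for i
    using that assms by (auto simp: ys nth_append)
  have dist: "distinct ?ys" by simp
  let ?v = "\<lambda>n. the (map_of (zip ([j] @ ?ys) ([x] @ y)) n)"
  have v: "?v (?ys ! i) = y ! i" if "i < k - 1" for i
  proof -
    have "?ys ! i \<noteq> j" using that len[OF that] nth_mem[of i ?ys] by auto
    then have "?v (?ys ! i) = the (map_of (zip ?ys y) (?ys ! i))" by auto
    also have "\<dots> = y ! i"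
      using map_of_zip_nth[OF _ dist, of y i] that assms len[OF that] by simp
    finally show ?thesis .
  qed
  have "map ?v [0..<k] = ins j x y"
  proof (rule nth_equalityI)
    show "length (map ?v [0..<k]) = length (ins j x y)" using assms by (simp add: ins_def)
  next
    fix i assume "i < length (map ?v [0..<k])"
    then have i: "i < k" by simp
    consider "i < j" | "i = j" | i' where "i = Suc i'" "j \<le> i'"
      by (metis Suc_le_D Suc_leI Suc_le_mono linorder_neqE_nat)
    then have "?v i = ins j x y ! i"
    proof cases
      case 1
      then have "i < k - 1" using assms by simp
      then show ?thesis
        using v[of i] ys_nth[of i] 1 assms by (simp add: ins_def nth_append)
    next
      case 2
      then show ?thesis using assms by (simp add: ins_def nth_append)
    next
      case 3
      then have "i' < k - 1" using i by simp
      then show ?thesis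
        using v[of i'] ys_nth[of i'] 3 assms by (simp add: ins_def nth_append min_def nth_Cons')
    qed
    moreover have "map ?v [0..<k] ! i = ?v i" using i by (subst nth_map) simp_all
    ultimately show "map ?v [0..<k] ! i = ins j x y ! i" by (rule trans[rotated])
  qed
  then show ?thesis by (simp only: sat2_def sat.simps)
qed

text \<open>All tuples that the branching condition inspects have their entries in
  \<open>set t\<close>, so passing to the induced substructure does not change the truth of the atom
  there.\<close>

lemma branching_of_tree:
  assumes "j < ar E" and t: "t \<in> trees (\<lambda>x y. ins j x y \<in> rel M E) (tuples X (ar E - 1)) n X"
  shows "branching (induced M (set t)) (Atom E [0..<ar E]) [j] (filter (\<lambda>x. x \<noteq> j) [0..<ar E]) n"
proof -
  let ?ys = "filter (\<lambda>x. x \<noteq> j) [0..<ar E]"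
  obtain a b where a: "\<forall>i. length i = n \<longrightarrow> a i \<in> X \<and> a i \<in> set t"
    and b: "\<forall>j. length j < n \<longrightarrow> b j \<in> tuples X (ar E - 1) \<and> set (b j) \<subseteq> set t"
    and ab: "\<forall>i l h. length i = n \<and> length l < n \<and> prefix (l @ [h]) i \<longrightarrow>
      (ins j (a i) (b l) \<in> rel M E \<longleftrightarrow> h)"
    using trees_branching[OF t] by blast
  have len: "length ?ys = ar E - 1"
  proof -
    have "length ?ys = card ({0..<ar E} - {j})"
      by (subst distinct_card[symmetric]) (auto intro: arg_cong[where f = card])
    then show ?thesis using assms by simp
  qed
  have "sat2 (induced M (set t)) (Atom E [0..<ar E]) [j] ?ys [a i] (b l) \<longleftrightarrow> h"
    if *: "length i = n \<and> length l < n \<and> prefix (l @ [h]) i" for i l h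
  proof -
    have "length (b l) = ar E - 1" using b * by (simp add: tuples_def)
    moreover have "set (ins j (a i) (b l)) \<subseteq> set t" using * a b by (simp add: set_ins)
    ultimately show ?thesis
      using ab * assms(1) by (simp add: sat2_atom induced_def)
  qed
  moreover have "length [a i] = length [j] \<and> set [a i] \<subseteq> univ (induced M (set t))"
    if "length i = n" for i using that a by (simp add: induced_def)
  moreover have "length (b l) = length ?ys \<and> set (b l) \<subseteq> univ (induced M (set t))"
    if "length l < n" for l using that b len by (simp add: induced_def tuples_def)
  ultimately show ?thesis
    unfolding branching_def by (intro exI[of _ "\<lambda>i. [a i]"] exI[of _ b]) blast
qed

lemma min_branching_exists:
  assumes "finite A" "branching (induced M A) p xs ys n"
  shows "\<exists>B\<subseteq>A. min_branching (induced M B) p xs ys n"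
  using assms
proof (induction A rule: finite_psubset_induct)
  case (psubset A)
  have ind: "induced (induced M A) B = induced M B" if "B \<subset> A" for B
    using that by (auto simp: induced_def)
  show ?case
  proof (cases "\<exists>B. B \<subset> A \<and> branching (induced M B) p xs ys n")
    case True
    then show ?thesis using psubset.IH by (meson order_trans psubset_imp_subset)
  next
    case False
    then have "min_branching (induced M A) p xs ys n"
      using psubset.prems ind by (auto simp: min_branching_def induced_def)
    then show ?thesis by blast
  qed
qed

text \<open>Lists of positions together with relations on indices into such a list. The number of
  patterns depends only on the language and \<open>D\<close>, not on a structure, which makes the
  density obtained from the pigeonhole uniform.\<close>

definition patterns :: "'s set \<Rightarrow> ('s \<Rightarrow> nat) \<Rightarrow> nat \<Rightarrow> (nat list \<times> ('s \<Rightarrow> nat list set)) set" where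
  "patterns L ar D = {js. set js \<subseteq> {..<D} \<and> length js \<le> D} \<times>
     (\<Pi>\<^sub>E E\<in>L. Pow (tuples {..<D} (ar E)))"

lemma finite_patterns: "finite L \<Longrightarrow> finite (patterns L ar D)"
  unfolding patterns_def
  by (intro finite_cartesian_product finite_lists_length_le finite_PiE) auto

lemma pigeonhole_fibre:
  assumes "finite S" "f ` S \<subseteq> T" "finite T" "S \<noteq> {}"
  obtains y where "y \<in> T" "card S \<le> card T * card {x \<in> S. f x = y}"
proof -
  have T: "T \<noteq> {}" using assms by auto
  define m where "m = Max ((\<lambda>y. card {x \<in> S. f x = y}) ` T)"
  have "m \<in> (\<lambda>y. card {x \<in> S. f x = y}) ` T"
    unfolding m_def using assms(3) T by (intro Max_in) auto
  then obtain y where y: "y \<in> T" "m = card {x \<in> S. f x = y}" by blast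
  have "card S = (\<Sum>y\<in>T. card {x \<in> S. f x = y})"
    using sum.group[OF assms(1,3,2), of "\<lambda>_. 1::nat"] by simp
  also have "\<dots> \<le> (\<Sum>y\<in>T. m)"
    using assms(3) by (intro sum_mono) (auto simp: m_def)
  finally show thesis using that[OF y(1)] y(2) by simp
qed

text \<open>
  The pattern of a branching tuple records the positions of a minimal branching substructure
  together with its isomorphism type. Tuples with the same pattern differ by an embedding of that
  substructure and by the entries at the remaining positions.
\<close>

lemma dense_branching_for_of_tuples:
  fixes M :: "('s, 'a) rel_structure"
  assumes "finite L" and M: "is_structure L ar M" and fin: "finite (univ M)"
    and S: "S \<subseteq> tuples (univ M) D" "\<And>t. t \<in> S \<Longrightarrow> branching (induced M (set t)) p xs ys n"
    and dense: "c * real (card (univ M)) ^ D \<le> card S" and "0 < c" and "univ M \<noteq> {}"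
  shows "dense_branching_for L ar M (c / card (patterns L ar D)) n p xs ys"
proof -
  define X where "X = univ M"
  let ?N = "real (card X)" and ?T = "patterns L ar D"
  have N: "0 < ?N" using assms by (simp add: X_def card_gt_0_iff)
  have S0: "S \<noteq> {}"
  proof
    assume "S = {}"
    moreover have "0 < c * ?N ^ D" using N \<open>0 < c\<close> by simp
    ultimately show False using dense by (simp add: X_def)
  qed
  have finS: "finite S" using S(1) fin finite_tuples finite_subset by blast
  have "\<exists>js. set js \<subseteq> {..<D} \<and> distinct (map ((!) t) js) \<and>
      min_branching (induced M (set (map ((!) t) js))) p xs ys n" if t: "t \<in> S" for t
  proof -
    obtain B where B: "B \<subseteq> set t" "min_branching (induced M B) p xs ys n"
      using min_branching_exists[OF _ S(2)[OF t]] by auto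
    obtain zs where zs: "set zs = B" "distinct zs"
      using finite_distinct_list[of B] B(1) finite_subset by blast
    have "\<forall>z\<in>set zs. \<exists>i<D. t ! i = z"
      using zs(1) B(1) t S(1) by (metis in_set_conv_nth subsetD tuples_length)
    then obtain f where f: "\<And>z. z \<in> set zs \<Longrightarrow> f z < D \<and> t ! f z = z" by metis
    then have "map ((!) t) (map f zs) = zs" by (auto intro: map_idI)
    then show ?thesis using f zs B(2) by (intro exI[of _ "map f zs"]) auto
  qed
  then obtain js where js: "\<And>t. t \<in> S \<Longrightarrow> set (js t) \<subseteq> {..<D}"
    "\<And>t. t \<in> S \<Longrightarrow> distinct (map ((!) t) (js t))"
    "\<And>t. t \<in> S \<Longrightarrow> min_branching (induced M (set (map ((!) t) (js t)))) p xs ys n"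
    by metis
  define sub where "sub t = map ((!) t) (js t)" for t
  \<comment> \<open>The relations are recorded on indices into \<open>sub t\<close> rather than on
    elements, so that the patterns of different tuples can be compared.\<close>
  define pat where "pat t = (\<lambda>E\<in>L. {u \<in> tuples {..<length (js t)} (ar E). map ((!) (sub t)) u \<in> rel M E})" for t
  have js_dist: "distinct (js t)" if "t \<in> S" for t
    using js(2)[OF that] by (simp add: distinct_map)
  have js_len: "length (js t) \<le> D" if "t \<in> S" for t
    using card_mono[OF _ js(1)[OF that]] distinct_card[OF js_dist[OF that]] by simp
  have "(\<lambda>t. (js t, pat t)) ` S \<subseteq> ?T"
  proof
    fix z assume "z \<in> (\<lambda>t. (js t, pat t)) ` S"
    then obtain t where "t \<in> S" "z = (js t, pat t)" by auto
    then show "z \<in> ?T"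
      using js(1)[of t] js_len[of t]
      by (fastforce simp: patterns_def pat_def tuples_def)
  qed
  from pigeonhole_fibre[OF finS this finite_patterns[OF \<open>finite L\<close>] S0]
  obtain y where y: "card S \<le> card ?T * card {t \<in> S. (js t, pat t) = y}" by blast
  define S' where "S' = {t \<in> S. (js t, pat t) = y}"
  have "S' \<noteq> {}"
  proof
    assume "S' = {}"
    then have "card S = 0" using y unfolding S'_def[symmetric] by simp
    then show False using finS S0 by simp
  qed
  then obtain t0 where t0: "t0 \<in> S'" by blast
  define js0 where "js0 = js t0"
  define s where "s = length js0"
  define z0 where "z0 = sub t0"
  define F where "F = induced M (set z0)"
  have S': "t \<in> S" "js t = js0" "pat t = pat t0" if "t \<in> S'" for t
    using that t0 by (auto simp: S'_def js0_def)
  have z0: "distinct z0" "length z0 = s" "set z0 \<subseteq> X"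
    using js(1,2)[OF S'(1)[OF t0]] S(1) S'(1)[OF t0]
    by (auto simp: z0_def sub_def s_def js0_def X_def tuples_def subset_iff)
  have cF: "card (univ F) = s" using distinct_card[OF z0(1)] z0(2) by (simp add: F_def induced_def)
  define Z where "Z = sub ` S'"
  have Z: "distinct z" "length z = s" "set z \<subseteq> X"
    "\<And>E u. E \<in> L \<Longrightarrow> u \<in> tuples {..<s} (ar E) \<Longrightarrow>
       map ((!) z) u \<in> rel M E \<longleftrightarrow> map ((!) z0) u \<in> rel M E" if zZ: "z \<in> Z" for z
  proof -
    obtain t where t: "t \<in> S'" "z = sub t" using zZ by (auto simp: Z_def)
    note t' = S'[OF t(1)]
    show "distinct z" "length z = s" "set z \<subseteq> X"
      using js(1,2)[OF t'(1)] t'(2) t(2) S(1) t'(1)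
      by (auto simp: sub_def s_def X_def tuples_def subset_iff)
    fix E u assume "E \<in> L" "u \<in> tuples {..<s} (ar E)"
    moreover have "pat t E = pat t0 E" using t' by simp
    ultimately show "map ((!) z) u \<in> rel M E \<longleftrightarrow> map ((!) z0) u \<in> rel M E"
      using t' by (auto simp: pat_def z0_def t(2) s_def js0_def)
  qed
  \<comment> \<open>Sends the \<open>i\<close>-th entry of the reference tuple \<open>z0\<close> to
    the \<open>i\<close>-th entry of \<open>z\<close>. Equal patterns make this an embedding, and
    distinct \<open>z\<close> give distinct maps.\<close>
  define \<phi> :: "'a list \<Rightarrow> 'a \<Rightarrow> 'a" where "\<phi> z = (\<lambda>x\<in>set z0. z ! (THE i. i < s \<and> z0 ! i = x))" for z
  have \<phi>: "\<phi> z (z0 ! i) = z ! i" if "i < s" for z i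
  proof -
    have "(THE i'. i' < s \<and> z0 ! i' = z0 ! i) = i"
      using that z0 by (intro the_equality) (auto simp: nth_eq_iff_index_eq)
    then show ?thesis using that z0 by (auto simp: \<phi>_def)
  qed
  have emb: "\<phi> z \<in> embeddings L ar F M" if "z \<in> Z" for z
    unfolding embeddings_def mem_Collect_eq
  proof (intro conjI ballI allI impI)
    have idx: "\<exists>i<s. x = z0 ! i" if "x \<in> set z0" for x
      using that z0(2) by (metis in_set_conv_nth)
    show "\<phi> z \<in> univ F \<rightarrow>\<^sub>E univ M"
    proof (rule PiE_I)
      fix x assume "x \<in> univ F"
      then obtain i where "i < s" "x = z0 ! i" using idx by (auto simp: F_def induced_def)
      then show "\<phi> z x \<in> univ M" using \<phi> Z(2,3)[OF that] by (auto simp: X_def)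
    qed (auto simp: \<phi>_def F_def induced_def)
    show "inj_on (\<phi> z) (univ F)"
    proof (rule inj_onI)
      fix x x' assume "x \<in> univ F" "x' \<in> univ F" and eq: "\<phi> z x = \<phi> z x'"
      then have "x \<in> set z0" "x' \<in> set z0" by (simp_all add: F_def induced_def)
      then obtain i i' where "i < s" "x = z0 ! i" "i' < s" "x' = z0 ! i'"
        using idx[of x] idx[of x'] by blast
      then show "x = x'" using eq \<phi> Z(1,2)[OF that] by (auto simp: nth_eq_iff_index_eq)
    qed
    fix E u assume "E \<in> L" and u: "length u = ar E \<and> set u \<subseteq> univ F"
    then have "\<forall>x\<in>set u. \<exists>i<s. x = z0 ! i" using idx by (auto simp: F_def induced_def)
    then obtain f where f: "\<And>x. x \<in> set u \<Longrightarrow> f x < s \<and> x = z0 ! f x" by metis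
    define v where "v = map f u"
    have v: "v \<in> tuples {..<s} (ar E)" using f u by (auto simp: v_def tuples_def)
    have "u = map ((!) z0) v" using f by (auto simp: v_def intro!: map_idI[symmetric])
    moreover have "\<phi> z x = z ! f x" if "x \<in> set u" for x
      using \<phi>[of "f x" z] f[OF that] by metis
    then have "map (\<phi> z) u = map ((!) z) v" by (simp add: v_def)
    moreover have "u \<in> rel F E \<longleftrightarrow> u \<in> rel M E" using u by (auto simp: F_def induced_def)
    ultimately show "u \<in> rel F E \<longleftrightarrow> map (\<phi> z) u \<in> rel M E"
      using Z(4)[OF that \<open>E \<in> L\<close> v] by metis
  qed
  have "inj_on \<phi> Z"
  proof (rule inj_onI)
    fix z z' assume "z \<in> Z" "z' \<in> Z" and eq: "\<phi> z = \<phi> z'"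
    show "z = z'"
    proof (rule nth_equalityI)
      show "length z = length z'" using Z(2) \<open>z \<in> Z\<close> \<open>z' \<in> Z\<close> by simp
      fix i assume "i < length z"
      then show "z ! i = z' ! i" using \<phi>[of i z] \<phi>[of i z'] eq Z(2)[OF \<open>z \<in> Z\<close>] by simp
    qed
  qed
  moreover have "embeddings L ar F M \<subseteq> univ F \<rightarrow>\<^sub>E univ M" by (auto simp: embeddings_def)
  then have "finite (embeddings L ar F M)"
    by (rule finite_subset) (use fin in \<open>auto simp: F_def induced_def intro: finite_PiE\<close>)
  ultimately have cZ: "card Z \<le> card (embeddings L ar F M)"
    using emb card_inj_on_le[of \<phi> Z] by blast
  \<comment> \<open>A tuple in \<open>S'\<close> is determined by its entries at the positions in
    \<open>js0\<close> and at the \<open>D - s\<close> others, so each element of \<open>Z\<close>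
    accounts for at most \<open>card X ^ (D - s)\<close> tuples.\<close>
  define ks where "ks = filter (\<lambda>i. i \<notin> set js0) [0..<D]"
  have ks: "length ks = D - s"
  proof -
    have "length ks = card ({..<D} - set js0)"
      unfolding ks_def by (subst distinct_card[symmetric]) (auto intro: arg_cong[where f = card])
    also have "\<dots> = D - s"
      using js(1)[OF S'(1)[OF t0]] distinct_card[OF js_dist[OF S'(1)[OF t0]]]
      by (subst card_Diff_subset) (auto simp: js0_def s_def)
    finally show ?thesis .
  qed
  have "card S' \<le> card (Z \<times> tuples X (D - s))"
  proof (rule card_inj_on_le)
    show "inj_on (\<lambda>t. (sub t, map ((!) t) ks)) S'"
    proof (rule inj_onI, clarify)
      fix t t' assume t: "t \<in> S'" "t' \<in> S'" and eq: "sub t = sub t'" "map ((!) t) ks = map ((!) t') ks"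
      have "length t = D" "length t' = D" using t S'(1) S(1) by (auto simp: tuples_def)
      moreover have "t ! i = t' ! i" if "i < D" for i
      proof (cases "i \<in> set js0")
        case True
        then show ?thesis using eq(1) S'(2) t by (auto simp: sub_def)
      next
        case False
        then show ?thesis using eq(2) that by (auto simp: ks_def)
      qed
      ultimately show "t = t'" by (intro nth_equalityI) auto
    qed
    show "(\<lambda>t. (sub t, map ((!) t) ks)) ` S' \<subseteq> Z \<times> tuples X (D - s)"
    proof clarify
      fix t assume t: "t \<in> S'"
      then have "t \<in> tuples X D" using S'(1) S(1) by (auto simp: X_def)
      then have "map ((!) t) ks \<in> tuples X (D - s)"
        using ks by (auto simp: tuples_def ks_def subset_iff)
      then show "sub t \<in> Z \<and> map ((!) t) ks \<in> tuples X (D - s)" using t by (simp add: Z_def)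
    qed
    have "finite S'" using finS by (simp add: S'_def)
    then show "finite (Z \<times> tuples X (D - s))" using fin by (simp add: Z_def X_def)
  qed
  then have cS': "card S' \<le> card Z * card X ^ (D - s)"
    using fin by (simp add: card_cartesian_product card_tuples X_def)
  have sD: "s \<le> D" using js_len[OF S'(1)[OF t0]] by (simp add: s_def js0_def)
  have sN: "s \<le> card X"
    using card_mono[OF _ z0(3)] fin distinct_card[OF z0(1)] z0(2) by (simp add: X_def)
  have T0: "0 < card ?T"
  proof (rule ccontr)
    assume "\<not> 0 < card ?T"
    then have "card S = 0" using y by simp
    then show False using finS S0 by simp
  qed
  \<comment> \<open>The induced density is normalised by this falling factorial. It is positive
    because \<open>z0\<close> has \<open>s\<close> distinct entries in \<open>X\<close>, and
    replacing it by \<open>?N ^ s\<close> only weakens the bound.\<close>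
  have prod: "0 < (\<Prod>i<s. ?N - real i)" "(\<Prod>i<s. ?N - real i) \<le> ?N ^ s"
  proof -
    show "0 < (\<Prod>i<s. ?N - real i)" using sN by (intro prod_pos) auto
    have "(\<Prod>i<s. ?N - real i) \<le> (\<Prod>i<s. ?N)" using sN by (intro prod_mono) auto
    then show "(\<Prod>i<s. ?N - real i) \<le> ?N ^ s" by simp
  qed
  have "c / card ?T * (\<Prod>i<s. ?N - real i) \<le> card (embeddings L ar F M)"
  proof -
    have "card S \<le> card ?T * (card Z * card X ^ (D - s))"
      using y cS' unfolding S'_def by (meson le_trans mult_le_mono2)
    then have "real (card S) \<le> real (card ?T * (card Z * card X ^ (D - s)))" by (rule of_nat_mono)
    then have "c * ?N ^ D \<le> card ?T * (card Z * ?N ^ (D - s))" using dense by (simp add: X_def)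
    moreover have "?N ^ D = ?N ^ s * ?N ^ (D - s)"
      using sD by (simp add: power_add[symmetric])
    ultimately have "(c * ?N ^ s) * ?N ^ (D - s) \<le> (card ?T * card Z) * ?N ^ (D - s)"
      by (simp add: mult_ac)
    then have "c * ?N ^ s \<le> card ?T * card Z" using N by simp
    then have "c / card ?T * ?N ^ s \<le> card Z" using T0 by (simp add: field_simps)
    moreover have "c / card ?T * (\<Prod>i<s. ?N - real i) \<le> c / card ?T * ?N ^ s"
      using prod(2) \<open>0 < c\<close> by (intro mult_left_mono) auto
    ultimately show ?thesis using cZ by linarith
  qed
  then have "c / card ?T \<le> t_ind L ar F M"
    using prod(1) by (simp add: t_ind_def cF X_def[symmetric] pos_le_divide_eq)
  moreover have "is_structure L ar F"
    using M by (auto simp: is_structure_def F_def induced_def)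
  moreover have "min_branching F p xs ys n"
    using js(3)[OF S'(1)[OF t0]] by (simp add: F_def z0_def sub_def)
  ultimately show ?thesis
    unfolding dense_branching_for_def by (intro exI[of _ F]) (auto simp: F_def induced_def)
qed

section \<open>The regular partition\<close>

text \<open>For \<open>n \<le> 1\<close>, trees are found in \<open>X\<close> itself if
  \<open>X\<close> is not good; for \<open>n \<ge> 2\<close>, in a set of density \<open>e\<close>
  none of whose subsets of density \<open>e ^ n\<close> is good. The minimum of the two tree bounds
  serves both cases. The first is singled out because \<open>g_exp\<close> vanishes there, so that
  the final bound does not grow with the number of coordinates.\<close>

lemma good_cover:
  fixes e :: real
  assumes fin: "finite X" and "X \<noteq> {}" and e: "0 < e" "e \<le> 1"
    and few: "card (trees R (tuples X q) n X)
      < min (tree_bound e n 1) (tree_bound e n e) * real (card X) ^ tree_length q n"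
  obtains \<A> where "disjoint \<A>" "\<Union>\<A> \<subseteq> X" "\<forall>A\<in>\<A>. good R (tuples X q) e A"
    and "real (card (X - \<Union>\<A>)) \<le> e * card X" and "real (card \<A>) \<le> 1 / e ^ n"
    and "n \<le> 1 \<Longrightarrow> \<A> = {X}"
proof -
  let ?N = "real (card X)"
  have N: "0 < ?N" using assms by (simp add: card_gt_0_iff)
  have few': "card (trees R (tuples X q) n X) < tree_bound e n a * ?N ^ tree_length q n"
    if "a = 1 \<or> a = e" for a
    by (rule less_le_trans[OF few], rule mult_right_mono) (use that in auto)
  show thesis
  proof (cases "n \<le> 1")
    case True
    have "good R (tuples X q) e X"
    proof (rule ccontr)
      assume bad: "\<not> good R (tuples X q) e X"
      have "tree_bound e n 1 * ?N ^ tree_length q n \<le> card (trees R (tuples X q) n X)"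
      proof (rule many_trees[where b = 1 and B = X])
        fix A assume "A \<subseteq> X" "1 * ?N \<le> card A"
        then have "A = X" using fin by (intro card_seteq) auto
        then show "\<not> good R (tuples X q) e A" using bad by simp
      qed (use True e fin in \<open>auto simp: le_Suc_eq\<close>)
      then show False using few'[of 1] by simp
    qed
    moreover have "1 \<le> 1 / e ^ n" using e by (simp add: power_le_one)
    ultimately show thesis using e by (intro that[of "{X}"]) (auto simp: disjoint_def)
  next
    case False
    have "\<exists>B'\<subseteq>B. good R (tuples X q) e B' \<and> e ^ n * ?N \<le> card B'"
      if B: "B \<subseteq> X" "e * ?N \<le> card B" for B
    proof (rule ccontr)
      assume "\<not> ?thesis"
      \<comment> \<open>The sets split in a tree of height \<open>n\<close> over a set of density
        \<open>e\<close> have density at least \<open>e * e ^ (n - 1) = e ^ n\<close>.\<close>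
      then have "tree_bound e n e * ?N ^ tree_length q n \<le> card (trees R (tuples X q) n B)"
        using B e fin by (intro many_trees[where b = "e ^ n" and B = B]) auto
      also have "\<dots> \<le> card (trees R (tuples X q) n X)"
        using B(1) fin by (intro of_nat_mono card_mono finite_trees trees_mono) auto
      finally show False using few'[of e] by simp
    qed
    moreover have "0 < e ^ n * ?N" "0 < e * ?N" using e N by auto
    ultimately obtain \<A> where \<A>: "disjoint \<A>" "\<Union>\<A> \<subseteq> X"
      "\<forall>B\<in>\<A>. good R (tuples X q) e B \<and> e ^ n * ?N \<le> card B" "real (card (X - \<Union>\<A>)) \<le> e * ?N"
      using greedy_cover[OF fin, of "e ^ n * ?N" "e * ?N" "good R (tuples X q) e"] by blast
    have "real (card \<A>) \<le> 1 / e ^ n"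
      using \<A> assms by (intro card_disjoint_family[of X]) auto
    then show thesis using \<A> False by (intro that[of \<A>]) auto
  qed
qed

text \<open>The tolerance \<open>\<epsilon> / 4\<close> per coordinate is turned into
  \<open>ar E * \<epsilon>\<close> by the factor \<open>4 * ar E\<close> from averaging and
  rounding. Each symbol is approximated separately; only the labelling \<open>h\<close> is
  shared.\<close>

lemma regular_partition_of_labelling:
  fixes M :: "('s, 'a) rel_structure" and h :: "'a \<Rightarrow> nat"
  assumes M: "is_structure L ar M" and fin: "finite (univ M)"
    and h: "h ` univ M \<subseteq> {..<m}"
    and size: "\<And>b. b < m \<Longrightarrow> card {x \<in> univ M. h x = b} \<in> {s, s + 1}"
    and inv: "\<And>E j t x. E \<in> L \<Longrightarrow> j < ar E \<Longrightarrow> t \<in> tuples (univ M) (ar E) \<Longrightarrow> x \<in> univ M \<Longrightarrow>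
      h x = h (t ! j) \<Longrightarrow> g E j (t[j := x]) = g E j t"
    and close: "\<And>E j. E \<in> L \<Longrightarrow> j < ar E \<Longrightarrow>
      real (card {t \<in> tuples (univ M) (ar E). (t \<in> rel M E) \<noteq> g E j t})
        \<le> \<epsilon> / 4 * real (card (univ M)) ^ ar E"
  shows "\<exists>(N :: ('s, 'a) rel_structure) P. is_structure L ar N \<and> univ N = univ M \<and>
    partition_on (univ M) P \<and> equitable P \<and>
    (\<forall>E\<in>L. real (card (sym_diff (rel M E) (rel N E)))
       \<le> real (ar E) * \<epsilon> * real (card (univ M)) ^ ar E) \<and>
    indivisible L ar N P \<and> card P \<le> m"
proof -
  define X where "X = univ M"
  define Q where "Q E R' \<longleftrightarrow> R' \<subseteq> tuples X (ar E) \<and>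
      (\<forall>t\<in>tuples X (ar E). \<forall>t'\<in>tuples X (ar E). map h t = map h t' \<longrightarrow> (t \<in> R' \<longleftrightarrow> t' \<in> R')) \<and>
      real (card (sym_diff (rel M E) R')) \<le> real (ar E) * \<epsilon> * real (card X) ^ ar E" for E R'
  have "\<exists>R'. Q E R'" if E: "E \<in> L" for E
  proof -
    have R: "rel M E \<subseteq> tuples X (ar E)"
      using M E by (auto simp: is_structure_def tuples_def X_def)
    have fX: "finite X" using fin by (simp add: X_def)
    show ?thesis
    proof (rule box_constant_approximation[OF fX R, of h "g E" "\<epsilon> / 4 * real (card X) ^ ar E"])
      show "g E j (t[j := x]) = g E j t"
        if "j < ar E" "t \<in> tuples X (ar E)" "x \<in> X" "h x = h (t ! j)" for j t x
        using inv[OF E] that by (simp add: X_def)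
      show "real (card {t \<in> tuples X (ar E). (t \<in> rel M E) \<noteq> g E j t}) \<le> \<epsilon> / 4 * real (card X) ^ ar E"
        if "j < ar E" for j
        using close[OF E that] by (simp add: X_def)
    next
      fix R' assume "R' \<subseteq> tuples X (ar E)" and
        "\<And>t t'. t \<in> tuples X (ar E) \<Longrightarrow> t' \<in> tuples X (ar E) \<Longrightarrow> map h t = map h t' \<Longrightarrow> t \<in> R' \<longleftrightarrow> t' \<in> R'"
        and "real (card (sym_diff (rel M E) R')) \<le> 4 * real (ar E) * (\<epsilon> / 4 * real (card X) ^ ar E)"
      moreover have "4 * real (ar E) * (\<epsilon> / 4 * real (card X) ^ ar E) = real (ar E) * \<epsilon> * real (card X) ^ ar E"
        by simp
      ultimately show ?thesis unfolding Q_def by (intro exI[of _ R'] conjI) (blast, blast, simp only:)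
    qed
  qed
  then have "\<forall>E\<in>L. \<exists>R'. Q E R'" by blast
  then obtain r where Q: "\<forall>E\<in>L. Q E (r E)" by (rule bchoice[THEN exE])
  have r: "\<And>E. E \<in> L \<Longrightarrow> r E \<subseteq> tuples X (ar E)"
    "\<And>E t t'. E \<in> L \<Longrightarrow> t \<in> tuples X (ar E) \<Longrightarrow> t' \<in> tuples X (ar E) \<Longrightarrow> map h t = map h t' \<Longrightarrow>
      t \<in> r E \<longleftrightarrow> t' \<in> r E"
    "\<And>E. E \<in> L \<Longrightarrow> real (card (sym_diff (rel M E) (r E))) \<le> real (ar E) * \<epsilon> * real (card X) ^ ar E"
    using Q unfolding Q_def by (blast, blast, simp only: Ball_def)
  define N where "N = \<lparr>univ = X, rel = r\<rparr>"
  \<comment> \<open>Only labels that occur give a part, so the parts are nonempty and there may be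
    fewer than \<open>m\<close>.\<close>
  define P where "P = block h X ` X"
  have N: "is_structure L ar N"
    using r(1) by (auto simp: is_structure_def N_def tuples_def)
  have part: "partition_on X P"
    unfolding partition_on_def P_def disjoint_def block_def by auto
  have PB: "P \<subseteq> (\<lambda>b. {x \<in> X. h x = b}) ` {..<m}"
    using h by (auto simp: P_def block_def X_def)
  have "card P \<le> card ((\<lambda>b. {x \<in> X. h x = b}) ` {..<m})"
    by (rule card_mono[OF _ PB]) simp
  also have "\<dots> \<le> m"
    using card_image_le[of "{..<m}" "\<lambda>b. {x \<in> X. h x = b}"] by simp
  finally have "card P \<le> m" .
  moreover have "equitable P"
    unfolding equitable_def
  proof (intro ballI)
    fix p p' assume "p \<in> P" "p' \<in> P"
    then obtain b b' where "b < m" "p = {x \<in> X. h x = b}" "b' < m" "p' = {x \<in> X. h x = b'}"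
      using PB by blast
    then show "card p \<le> card p' + 1" using size[of b] size[of b'] by (auto simp: X_def)
  qed
  moreover have "indivisible L ar N P"
    unfolding indivisible_def
  proof (intro ballI allI impI)
    fix E ps a0 a1
    assume E: "E \<in> L" and *: "length ps = ar E \<and> set ps \<subseteq> P \<and> list_all2 (\<in>) a0 ps \<and> list_all2 (\<in>) a1 ps"
    have len: "length a0 = ar E" "length a1 = ar E" using * by (auto dest: list_all2_lengthD)
    have nth: "ps ! i \<in> P" "a0 ! i \<in> ps ! i" "a1 ! i \<in> ps ! i" if "i < ar E" for i
      using * that by (auto simp: list_all2_conv_all_nth)
    have "a0 ! i \<in> X \<and> a1 ! i \<in> X \<and> h (a0 ! i) = h (a1 ! i)" if "i < ar E" for i
      using nth[OF that] by (auto simp: P_def block_def)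
    then have "a0 \<in> tuples X (ar E)" "a1 \<in> tuples X (ar E)" "map h a0 = map h a1"
      using len by (auto simp: tuples_def in_set_conv_nth intro!: nth_equalityI)
    then show "a0 \<in> rel N E \<longleftrightarrow> a1 \<in> rel N E" using r(2)[OF E, of a0 a1] by (simp add: N_def)
  qed
  ultimately show ?thesis
    using N part r(3) by (intro exI[of _ N] exI[of _ P] conjI) (auto simp: N_def X_def)
qed

text \<open>Splitting \<open>t\<close> into its entry at \<open>j\<close> and the rest is injective,
  so error bounds for the binary relation carry over to tuples.\<close>

lemma card_tuples_le_pairs:
  assumes "finite X" "j < k" and "\<And>t. t \<in> tuples X k \<Longrightarrow> Q t \<Longrightarrow> Q' (t ! j) (del j t)"
  shows "card {t \<in> tuples X k. Q t} \<le> card {(x, y) \<in> X \<times> tuples X (k - 1). Q' x y}"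
proof (rule card_inj_on_le)
  show "inj_on (\<lambda>t. (t ! j, del j t)) {t \<in> tuples X k. Q t}"
  proof (rule inj_onI)
    fix t t' assume t: "t \<in> {t \<in> tuples X k. Q t}" "t' \<in> {t \<in> tuples X k. Q t}"
      and eq: "(t ! j, del j t) = (t' ! j, del j t')"
    have "t = ins j (t ! j) (del j t)" "ins j (t' ! j) (del j t') = t'"
      using t assms(2) ins_del[of j t] ins_del[of j t'] by (auto simp: tuples_length)
    then show "t = t'" using eq by (metis prod.inject)
  qed
  show "(\<lambda>t. (t ! j, del j t)) ` {t \<in> tuples X k. Q t} \<subseteq> {(x, y) \<in> X \<times> tuples X (k - 1). Q' x y}"
    using assms del_in_tuples[of _ X "k - 1" j] by (auto simp: tuples_nth)
  have "finite (X \<times> tuples X (k - 1))" using assms(1) by simp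
  then show "finite {(x, y) \<in> X \<times> tuples X (k - 1). Q' x y}"
    by (rule rev_finite_subset) auto
qed

text \<open>
  Elements of blocks of \<open>h\<close> that mix several labels are sent to \<open>False\<close>, which makes the
  approximation invariant on all blocks.
\<close>

lemma regular_partition_of_covers:
  fixes M :: "('s, 'a) rel_structure" and h :: "'a \<Rightarrow> nat"
  assumes M: "is_structure L ar M" and fin: "finite (univ M)" and "0 < \<epsilon>"
    and h: "h ` univ M \<subseteq> {..<m}"
    and size: "\<And>b. b < m \<Longrightarrow> card {x \<in> univ M. h x = b} \<in> {s, s + 1}"
    and cover: "\<And>E j. E \<in> L \<Longrightarrow> j < ar E \<Longrightarrow> disjoint (\<A> E j) \<and> \<Union>(\<A> E j) \<subseteq> univ M \<and>
      (\<forall>A\<in>\<A> E j. good (\<lambda>x y. ins j x y \<in> rel M E) (tuples (univ M) (ar E - 1)) (\<epsilon> / 16) A) \<and>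
      real (card (univ M - \<Union>(\<A> E j))) \<le> \<epsilon> / 16 * card (univ M)"
    and C: "\<And>E j x y. E \<in> L \<Longrightarrow> j < ar E \<Longrightarrow> C x = C y \<Longrightarrow> x \<in> univ M \<Longrightarrow> y \<in> univ M \<Longrightarrow>
      label (\<A> E j) x = label (\<A> E j) y"
    and mixed: "real (card {x \<in> univ M. \<exists>x'\<in>univ M. h x' = h x \<and> C x' \<noteq> C x}) \<le> \<epsilon> / 16 * card (univ M)"
  shows "\<exists>(N :: ('s, 'a) rel_structure) P. is_structure L ar N \<and> univ N = univ M \<and>
    partition_on (univ M) P \<and> equitable P \<and>
    (\<forall>E\<in>L. real (card (sym_diff (rel M E) (rel N E)))
       \<le> real (ar E) * \<epsilon> * real (card (univ M)) ^ ar E) \<and>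
    indivisible L ar N P \<and> card P \<le> m"
proof -
  define X where "X = univ M"
  define mix where "mix x \<longleftrightarrow> (\<exists>x'\<in>X. h x' = h x \<and> C x' \<noteq> C x)" for x
  let ?R = "\<lambda>E j x y. ins j x y \<in> rel M E"
  let ?maj = "\<lambda>E j x. majority (?R E j) (label (\<A> E j) x)"
  define g where "g E j t \<longleftrightarrow> \<not> mix (t ! j) \<and> ?maj E j (t ! j) (del j t)" for E j t
  show ?thesis
  proof (rule regular_partition_of_labelling[OF M fin h size])
    fix E j t x
    assume *: "E \<in> L" "j < ar E" "t \<in> tuples (univ M) (ar E)" "x \<in> univ M" "h x = h (t ! j)"
    have tj: "t ! j \<in> X" "j < length t" using * by (auto simp: X_def tuples_nth tuples_length)
    show "g E j (t[j := x]) = g E j t"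
    proof (cases "C x = C (t ! j)")
      case True
      then have "mix x \<longleftrightarrow> mix (t ! j)" using * by (simp add: mix_def)
      then show ?thesis using True C[OF *(1,2) True] * tj by (simp add: g_def del_update X_def)
    next
      case False
      \<comment> \<open>\<open>x\<close> and \<open>t ! j\<close> lie in one block and witness for
        each other that it is mixed.\<close>
      then have "mix x" "mix (t ! j)" using * tj unfolding mix_def X_def by metis+
      then show ?thesis using tj by (simp add: g_def)
    qed
  next
    fix E j assume E: "E \<in> L" "j < ar E"
    let ?Y = "tuples X (ar E - 1)" and ?n = "real (card X)"
    have fX: "finite X" using fin by (simp add: X_def)
    have n: "?n ^ ar E = ?n * card ?Y"
      using E(2) fX by (cases "ar E") (auto simp: card_tuples)
    note cov = cover[OF E, folded X_def]
    have "real (card {t \<in> tuples X (ar E). (t \<in> rel M E) \<noteq> ?maj E j (t ! j) (del j t)})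
        \<le> card {(x, y) \<in> X \<times> ?Y. ?R E j x y \<noteq> ?maj E j x y}"
      using E(2) fX by (intro of_nat_mono card_tuples_le_pairs) (auto simp: ins_del tuples_length)
    also have "\<dots> \<le> 3 * (\<epsilon> / 16) * ?n * card ?Y"
      using cov fX \<open>0 < \<epsilon>\<close> by (intro majority_error) auto
    finally have 1: "real (card {t \<in> tuples X (ar E). (t \<in> rel M E) \<noteq> ?maj E j (t ! j) (del j t)})
        \<le> 3 * (\<epsilon> / 16) * ?n * card ?Y" .
    have "real (card {t \<in> tuples X (ar E). mix (t ! j)}) \<le> card {(x, y) \<in> X \<times> ?Y. mix x}"
      using E(2) fX by (intro of_nat_mono card_tuples_le_pairs) auto
    also have "{(x, y) \<in> X \<times> ?Y. mix x} = {x \<in> X. mix x} \<times> ?Y" by auto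
    also have "real (card \<dots>) \<le> \<epsilon> / 16 * ?n * card ?Y"
      using mixed unfolding card_cartesian_product of_nat_mult
      by (intro mult_right_mono) (auto simp: mix_def X_def)
    finally have 2: "real (card {t \<in> tuples X (ar E). mix (t ! j)}) \<le> \<epsilon> / 16 * ?n * card ?Y" .
    \<comment> \<open>Three sixteenths of \<open>\<epsilon>\<close> from the majority approximation
      and one from the mixed blocks add up to \<open>\<epsilon> / 4\<close>.\<close>
    have "card {t \<in> tuples X (ar E). (t \<in> rel M E) \<noteq> g E j t}
        \<le> card ({t \<in> tuples X (ar E). (t \<in> rel M E) \<noteq> ?maj E j (t ! j) (del j t)}
          \<union> {t \<in> tuples X (ar E). mix (t ! j)})"
      using fX by (intro card_mono) (auto simp: g_def)
    also have "\<dots> \<le> card {t \<in> tuples X (ar E). (t \<in> rel M E) \<noteq> ?maj E j (t ! j) (del j t)}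
          + card {t \<in> tuples X (ar E). mix (t ! j)}"
      by (rule card_Un_le)
    finally have "real (card {t \<in> tuples X (ar E). (t \<in> rel M E) \<noteq> g E j t})
        \<le> 3 * (\<epsilon> / 16) * ?n * card ?Y + \<epsilon> / 16 * ?n * card ?Y"
      using 1 2 by linarith
    also have "\<dots> = \<epsilon> / 4 * ?n ^ ar E" by (simp add: n algebra_simps)
    finally show "real (card {t \<in> tuples (univ M) (ar E). (t \<in> rel M E) \<noteq> g E j t})
        \<le> \<epsilon> / 4 * real (card (univ M)) ^ ar E"
      by (simp add: X_def)
  qed
qed

text \<open>Otherwise the trees would be a dense set of branching tuples of one length, and a
  minimal structure of density \<open>c\<close> divided by the number of patterns would exist. That
  quotient depends on the symbol but not on the structure, so its minimum over \<open>L\<close>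
  serves as \<open>\<delta>\<close>.\<close>

lemma few_trees_of_not_dense:
  fixes L :: "'s set" and ar :: "'s \<Rightarrow> nat"
  assumes "finite L" and "0 < c"
  obtains \<delta> where "0 < \<delta>"
    and "\<And>(M :: ('s, 'a) rel_structure) E j. is_structure L ar M \<Longrightarrow> finite (univ M) \<Longrightarrow> univ M \<noteq> {} \<Longrightarrow>
      \<not> dense_branching L ar M \<delta> \<tau> \<Longrightarrow> E \<in> L \<Longrightarrow> j < ar E \<Longrightarrow>
      card (trees (\<lambda>x y. ins j x y \<in> rel M E) (tuples (univ M) (ar E - 1)) \<tau> (univ M))
        < c * real (card (univ M)) ^ tree_length (ar E - 1) \<tau>"
proof
  let ?D = "\<lambda>E. tree_length (ar E - 1) \<tau>"
  let ?\<delta> = "\<lambda>E. c / real (card (patterns L ar (?D E)))"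
  \<comment> \<open>The element 1 keeps the minimum defined for empty \<open>L\<close>.\<close>
  let ?m = "Min (insert 1 (?\<delta> ` L))"
  have "patterns L ar D \<noteq> {}" for D
    unfolding patterns_def by (auto simp: PiE_eq_empty_iff intro!: exI[of _ "[]"])
  then have "0 < ?\<delta> E" for E
    using finite_patterns[OF assms(1), of ar] assms(2) by (simp add: card_gt_0_iff)
  then show "0 < ?m"
    using assms(1) by (subst Min_gr_iff) auto
  fix M :: "('s, 'a) rel_structure" and E j
  assume M: "is_structure L ar M" "finite (univ M)" "univ M \<noteq> {}" and
    not_dense: "\<not> dense_branching L ar M ?m \<tau>" and E: "E \<in> L" "j < ar E"
  let ?S = "trees (\<lambda>x y. ins j x y \<in> rel M E) (tuples (univ M) (ar E - 1)) \<tau> (univ M)"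
  let ?ys = "filter (\<lambda>x. x \<noteq> j) [0..<ar E]"
  show "card ?S < c * real (card (univ M)) ^ ?D E"
  proof (rule ccontr)
    assume "\<not> ?thesis"
    then have "dense_branching_for L ar M (?\<delta> E) \<tau> (Atom E [0..<ar E]) [j] ?ys"
      using assms M E
      by (intro dense_branching_for_of_tuples[where S = ?S])
        (auto simp: not_less intro!: branching_of_tree trees_subset_tuples[THEN subsetD])
    moreover have "?m \<le> ?\<delta> E" using assms(1) E by (intro Min_le) auto
    ultimately have "dense_branching_for L ar M ?m \<tau> (Atom E [0..<ar E]) [j] ?ys"
      unfolding dense_branching_for_def by (meson order_trans)
    then show False using not_dense E unfolding dense_branching_def by blast
  qed
qed

definition good_covers ::
  "'s set \<Rightarrow> ('s \<Rightarrow> nat) \<Rightarrow> ('s, 'a) rel_structure \<Rightarrow> real \<Rightarrow> ('s \<Rightarrow> nat \<Rightarrow> 'a set set) \<Rightarrow> bool" where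
  "good_covers L ar M e \<A> \<longleftrightarrow> (\<forall>E\<in>L. \<forall>j<ar E. disjoint (\<A> E j) \<and> \<Union>(\<A> E j) \<subseteq> univ M \<and>
     (\<forall>A\<in>\<A> E j. good (\<lambda>x y. ins j x y \<in> rel M E) (tuples (univ M) (ar E - 1)) e A) \<and>
     real (card (univ M - \<Union>(\<A> E j))) \<le> e * card (univ M))"

lemma good_covers_of_not_dense:
  fixes L :: "'s set" and ar :: "'s \<Rightarrow> nat" and e :: real
  assumes "finite L" and e: "0 < e" "e \<le> 1"
  obtains \<delta> where "0 < \<delta>"
    and "\<And>M :: ('s, 'a) rel_structure. is_structure L ar M \<Longrightarrow> finite (univ M) \<Longrightarrow> univ M \<noteq> {} \<Longrightarrow>
      \<not> dense_branching L ar M \<delta> \<tau> \<Longrightarrow> \<exists>\<A>. good_covers L ar M e \<A> \<and>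
        (\<forall>E\<in>L. \<forall>j<ar E. real (card (\<A> E j)) \<le> 1 / e ^ \<tau> \<and> (\<tau> \<le> 1 \<longrightarrow> \<A> E j = {univ M}))"
proof -
  let ?c = "min (tree_bound e \<tau> 1) (tree_bound e \<tau> e)"
  have "0 < ?c" using tree_bound_pos e by simp
  from few_trees_of_not_dense[OF assms(1) this, of ar \<tau>, where ?'a = 'a]
  obtain \<delta> where "0 < \<delta>" and few: "\<And>(M :: ('s, 'a) rel_structure) E j. is_structure L ar M \<Longrightarrow>
      finite (univ M) \<Longrightarrow> univ M \<noteq> {} \<Longrightarrow> \<not> dense_branching L ar M \<delta> \<tau> \<Longrightarrow> E \<in> L \<Longrightarrow> j < ar E \<Longrightarrow>
      card (trees (\<lambda>x y. ins j x y \<in> rel M E) (tuples (univ M) (ar E - 1)) \<tau> (univ M))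
        < ?c * real (card (univ M)) ^ tree_length (ar E - 1) \<tau>"
    by metis
  show thesis
  proof (rule that[OF \<open>0 < \<delta>\<close>])
    fix M :: "('s, 'a) rel_structure"
    assume M: "is_structure L ar M" "finite (univ M)" "univ M \<noteq> {}" "\<not> dense_branching L ar M \<delta> \<tau>"
    let ?Q = "\<lambda>E j \<A>. disjoint \<A> \<and> \<Union>\<A> \<subseteq> univ M \<and>
     (\<forall>A\<in>\<A>. good (\<lambda>x y. ins j x y \<in> rel M E) (tuples (univ M) (ar E - 1)) e A) \<and>
     real (card (univ M - \<Union>\<A>)) \<le> e * card (univ M) \<and>
     real (card \<A>) \<le> 1 / e ^ \<tau> \<and> (\<tau> \<le> 1 \<longrightarrow> \<A> = {univ M})"
    have "\<exists>\<A>. ?Q E j \<A>" if "E \<in> L" "j < ar E" for E j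
      by (rule good_cover[OF M(2,3) e few[OF M that]]) blast
    then have "\<forall>p\<in>Sigma L (\<lambda>E. {..<ar E}). \<exists>\<A>. ?Q (fst p) (snd p) \<A>" by auto
    then obtain \<A> where "\<forall>p\<in>Sigma L (\<lambda>E. {..<ar E}). ?Q (fst p) (snd p) (\<A> p)"
      by (rule bchoice[THEN exE])
    then have "?Q E j (\<A> (E, j))" if "E \<in> L" "j < ar E" for E j using that by fastforce
    then show "\<exists>\<A>. good_covers L ar M e \<A> \<and>
        (\<forall>E\<in>L. \<forall>j<ar E. real (card (\<A> E j)) \<le> 1 / e ^ \<tau> \<and> (\<tau> \<le> 1 \<longrightarrow> \<A> E j = {univ M}))"
      unfolding good_covers_def by (intro exI[of _ "\<lambda>E j. \<A> (E, j)"]) blast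
  qed
qed

lemma card_symbol_positions:
  assumes "finite L"
  shows "card (Sigma L (\<lambda>E. {..<ar E})) \<le> lang_size L ar"
proof -
  have "card (Sigma L (\<lambda>E. {..<ar E})) = (\<Sum>E\<in>L. ar E)" using assms by simp
  also have "\<dots> \<le> (\<Sum>E\<in>L. max_arity L ar)"
    using assms by (intro sum_mono) (auto simp: max_arity_def)
  finally show ?thesis by (simp add: lang_size_def)
qed

text \<open>Extensional on the pairs \<open>(E, j)\<close>, so that its values lie in a finite
  product and can be counted.\<close>

definition joint_label ::
  "'s set \<Rightarrow> ('s \<Rightarrow> nat) \<Rightarrow> ('s \<Rightarrow> nat \<Rightarrow> 'a set set) \<Rightarrow> 'a \<Rightarrow> 's \<times> nat \<Rightarrow> 'a set" where
  "joint_label L ar \<A> x = (\<lambda>(E, j)\<in>Sigma L (\<lambda>E. {..<ar E}). label (\<A> E j) x)"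

lemma joint_label_eqD:
  "joint_label L ar \<A> x = joint_label L ar \<A> y \<Longrightarrow> E \<in> L \<Longrightarrow> j < ar E \<Longrightarrow>
    label (\<A> E j) x = label (\<A> E j) y"
  by (drule fun_cong[of _ _ "(E, j)"]) (simp add: joint_label_def)

text \<open>The strict bound on \<open>card (\<A> E j)\<close> leaves room for the additional label
  \<open>{}\<close> of uncovered elements, so each of the at most \<open>lang_size L ar\<close>
  pairs allows \<open>c\<close> labels.\<close>

lemma card_joint_label_image:
  assumes "finite L" and \<A>: "\<And>E j. E \<in> L \<Longrightarrow> j < ar E \<Longrightarrow>
      disjoint (\<A> E j) \<and> finite (\<A> E j) \<and> card (\<A> E j) < c"
    and "0 < c"
  shows "card (joint_label L ar \<A> ` X) \<le> c ^ lang_size L ar"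
proof -
  let ?I = "Sigma L (\<lambda>E. {..<ar E})"
  let ?T = "\<Pi>\<^sub>E p\<in>?I. insert {} (\<A> (fst p) (snd p))"
  have I: "finite ?I" using assms(1) by simp
  have card: "card (insert {} (\<A> (fst p) (snd p))) \<le> c" and fin: "finite (insert {} (\<A> (fst p) (snd p)))"
    if "p \<in> ?I" for p
    using \<A>[of "fst p" "snd p"] that card_insert_le_m1[of c "\<A> (fst p) (snd p)" "{}"] \<open>0 < c\<close>
    by auto
  have "joint_label L ar \<A> ` X \<subseteq> ?T"
  proof
    fix l assume "l \<in> joint_label L ar \<A> ` X"
    then obtain x where x: "x \<in> X" "l = joint_label L ar \<A> x" by blast
    have "label (\<A> E j) x \<in> insert {} (\<A> E j)" if "E \<in> L" "j < ar E" for E j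
      using label_image[of "\<A> E j" X] \<A>[OF that] x(1) by blast
    then have "(case p of (E, j) \<Rightarrow> label (\<A> E j) x) \<in> insert {} (\<A> (fst p) (snd p))"
      if "p \<in> ?I" for p using that by (cases p) simp
    then show "l \<in> ?T" unfolding x(2) joint_label_def restrict_PiE_iff by blast
  qed
  then have "card (joint_label L ar \<A> ` X) \<le> card ?T"
    using I fin by (intro card_mono finite_PiE) auto
  also have "\<dots> = (\<Prod>p\<in>?I. card (insert {} (\<A> (fst p) (snd p))))"
    using I by (rule card_PiE)
  also have "\<dots> \<le> (\<Prod>p\<in>?I. c)" using card by (intro prod_mono) auto
  also have "\<dots> = c ^ card ?I" by simp
  also have "\<dots> \<le> c ^ lang_size L ar"
    using \<open>0 < c\<close> card_symbol_positions[OF assms(1)] by (intro power_increasing) auto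
  finally show ?thesis .
qed

section \<open>Numerical bounds on the number of parts\<close>

lemma g_exp_nonneg: "0 \<le> g_exp L ar \<tau>"
proof (cases "\<tau> = 0")
  case False
  then have "0 \<le> 5 * real (lang_size L ar) * real \<tau> * log 2 (real \<tau>)" by simp
  then show ?thesis unfolding g_exp_def by linarith
qed (simp add: g_exp_def)

lemma g_exp_lower:
  assumes "2 \<le> \<tau>"
  shows "5 * int (lang_size L ar) * int \<tau> \<le> g_exp L ar \<tau>"
proof -
  have "1 \<le> log 2 (real \<tau>)" using assms by simp
  then have "5 * real (lang_size L ar) * real \<tau> * 1
      \<le> 5 * real (lang_size L ar) * real \<tau> * log 2 (real \<tau>)"
    by (intro mult_left_mono) auto
  then have "of_int (5 * int (lang_size L ar) * int \<tau>) \<le> 5 * real (lang_size L ar) * real \<tau> * log 2 (real \<tau>)"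
    by simp
  then show ?thesis unfolding g_exp_def by linarith
qed

text \<open>For \<open>\<epsilon> \<le> 2\<close> the new base is at least 1 and its natural powers
  increase with the exponent, which is how the bound is met later.\<close>

lemma parts_bound:
  fixes \<epsilon> :: real
  assumes "0 < \<epsilon>"
  shows "(\<epsilon> / 2) powi (- g_exp L ar \<tau> - 2) = (2 / \<epsilon>) ^ nat (g_exp L ar \<tau> + 2)"
proof -
  have "- g_exp L ar \<tau> - 2 = - int (nat (g_exp L ar \<tau> + 2))"
    using g_exp_nonneg[of L ar \<tau>] by simp
  then have "(\<epsilon> / 2) powi (- g_exp L ar \<tau> - 2) = inverse ((\<epsilon> / 2) ^ nat (g_exp L ar \<tau> + 2))"
    by (simp only: power_int_minus power_int_of_nat)
  also have "\<dots> = (2 / \<epsilon>) ^ nat (g_exp L ar \<tau> + 2)" by (simp add: power_inverse[symmetric])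
  finally show ?thesis .
qed

text \<open>Powers of \<open>w = 2 / \<epsilon> > 4\<close> absorb the constants: each of the
  \<open>lang_size L ar\<close> factors of \<open>K\<close> is at most
  \<open>(16 * w) ^ \<tau> \<le> w ^ (3 * \<tau>)\<close>, and
  \<open>32 / \<epsilon> = 16 * w\<close> together with the rounding costs at most
  \<open>w ^ 4\<close>. The coefficient 5 in \<open>g_exp\<close> covers the sum of the exponents
  since \<open>\<tau> * lang_size L ar \<ge> 2\<close>.\<close>

lemma number_of_parts:
  fixes \<epsilon> :: real
  assumes \<epsilon>: "0 < \<epsilon>" "\<epsilon> < 1 / 2" and \<tau>: "2 \<le> \<tau>" and \<l>: "1 \<le> lang_size L ar"
    and K: "K = (nat \<lfloor>1 / (\<epsilon> / 16) ^ \<tau>\<rfloor> + 1) ^ lang_size L ar"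
  shows "real (nat \<lceil>32 * real K / \<epsilon>\<rceil>) \<le> (2 / \<epsilon>) ^ nat (g_exp L ar \<tau> + 2)"
proof -
  define w where "w = 2 / \<epsilon>"
  have w: "4 < w" using \<epsilon> by (simp add: w_def field_simps)
  let ?l = "lang_size L ar" and ?K0 = "nat \<lfloor>1 / (\<epsilon> / 16) ^ \<tau>\<rfloor> + 1"
  have "1 / (\<epsilon> / 16) ^ \<tau> = (8 * w) ^ \<tau>"
    by (simp add: w_def power_divide)
  moreover have "0 \<le> (8 * w) ^ \<tau>" using w by simp
  ultimately have "real ?K0 \<le> (8 * w) ^ \<tau> + 1" by simp
  also have "\<dots> \<le> 2 * (8 * w) ^ \<tau>" using w one_le_power[of "8 * w" \<tau>] by linarith
  also have "\<dots> \<le> 2 ^ \<tau> * (8 * w) ^ \<tau>"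
    using w \<tau> self_le_power[of "2 :: real" \<tau>] by (intro mult_right_mono) auto
  also have "\<dots> = (2 * (8 * w)) ^ \<tau>" by (rule power_mult_distrib[symmetric])
  also have "2 * (8 * w) = 16 * w" by simp
  also have "(16 * w) ^ \<tau> \<le> (w ^ 3) ^ \<tau>"
  proof (rule power_mono)
    have "4 * 4 \<le> w * w" using w by (intro mult_mono) auto
    then have "16 * w \<le> w * w * w" using w by (intro mult_right_mono) auto
    then show "16 * w \<le> w ^ 3" by (simp add: power3_eq_cube)
  qed (use w in auto)
  finally have "real ?K0 \<le> w ^ (3 * \<tau>)" by (simp add: power_mult)
  then have "real ?K0 ^ ?l \<le> (w ^ (3 * \<tau>)) ^ ?l" by (rule power_mono) simp
  then have Kw: "real K \<le> w ^ (3 * \<tau> * ?l)" unfolding K by (simp add: power_mult)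
  have K1: "1 \<le> real K" unfolding K by simp
  have "real (nat \<lceil>32 * real K / \<epsilon>\<rceil>) \<le> 32 * real K / \<epsilon> + 1"
  proof -
    have "0 \<le> 32 * real K / \<epsilon>" using \<epsilon> by simp
    then have "real (nat \<lceil>32 * real K / \<epsilon>\<rceil>) = of_int \<lceil>32 * real K / \<epsilon>\<rceil>" by simp
    then show ?thesis by linarith
  qed
  also have "\<dots> = 16 * w * real K + 1" by (simp add: w_def)
  also have "\<dots> \<le> 17 * w * real K"
    using mult_mono[of 1 w 1 "real K"] w K1 by (simp add: algebra_simps)
  also have "\<dots> \<le> w ^ 4 * real K"
  proof (rule mult_right_mono)
    have "4 * 4 * 4 \<le> w * w * w" using w by (intro mult_mono) auto
    then have "17 * w \<le> w * w * w * w" using w by (intro mult_right_mono) auto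
    then show "17 * w \<le> w ^ 4" by (simp add: power4_eq_xxxx)
  qed simp
  also have "\<dots> \<le> w ^ 4 * w ^ (3 * \<tau> * ?l)" using Kw w by (intro mult_left_mono) auto
  also have "\<dots> = w ^ (4 + 3 * \<tau> * ?l)" by (simp add: power_add)
  also have "\<dots> \<le> w ^ nat (g_exp L ar \<tau> + 2)"
  proof (rule power_increasing)
    have "2 * 1 \<le> \<tau> * ?l" using \<tau> \<l> by (rule mult_le_mono)
    then have "4 + 3 * \<tau> * ?l \<le> 5 * (\<tau> * ?l)" by (simp add: mult.assoc)
    moreover have "5 * int ?l * int \<tau> = int (5 * (\<tau> * ?l))" by simp
    ultimately show "4 + 3 * \<tau> * ?l \<le> nat (g_exp L ar \<tau> + 2)"
      using g_exp_lower[OF \<tau>, of L ar] by linarith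
  qed (use w in simp)
  finally show ?thesis by (simp add: w_def)
qed

text \<open>Replacing each relation by the nearer of the empty and the full one changes at most half
  of the tuples, which is allowed for positive arity. For arity 0 no error is allowed; the relation
  is kept, and it is indivisible because there is only the empty tuple.\<close>

lemma single_part_approximation:
  fixes M :: "('s, 'a) rel_structure" and \<epsilon> :: real
  assumes M: "is_structure L ar M" and fin: "finite (univ M)" and "univ M \<noteq> {}" and \<epsilon>: "1 / 2 \<le> \<epsilon>"
  shows "\<exists>(N :: ('s, 'a) rel_structure) P. is_structure L ar N \<and> univ N = univ M \<and>
    partition_on (univ M) P \<and> equitable P \<and>
    (\<forall>E\<in>L. real (card (sym_diff (rel M E) (rel N E)))
       \<le> real (ar E) * \<epsilon> * real (card (univ M)) ^ ar E) \<and>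
    indivisible L ar N P \<and> card P \<le> 1"
proof -
  define X where "X = univ M"
  define r where "r E = (if ar E = 0 then rel M E
    else if 2 * card (rel M E) \<le> card X ^ ar E then {} else tuples X (ar E))" for E
  define N where "N = \<lparr>univ = X, rel = r\<rparr>"
  have R: "rel M E \<subseteq> tuples X (ar E)" if "E \<in> L" for E
    using M that by (auto simp: is_structure_def tuples_def X_def)
  have fX: "finite X" using fin by (simp add: X_def)
  have "r E \<subseteq> tuples X (ar E)" if "E \<in> L" for E
    using R[OF that] unfolding r_def by (auto split: if_splits simp del: power_0)
  then have "is_structure L ar N"
    by (auto simp: is_structure_def N_def tuples_def)
  moreover have "partition_on X {X}"
    using assms(3) by (intro partition_on_space) (auto simp: X_def)
  moreover have "real (card (sym_diff (rel M E) (r E))) \<le> real (ar E) * \<epsilon> * real (card X) ^ ar E"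
    if E: "E \<in> L" for E
  proof (cases "ar E = 0")
    case True
    then show ?thesis by (simp add: r_def)
  next
    case False
    have "2 * card (sym_diff (rel M E) (r E)) \<le> card X ^ ar E"
    proof (cases "2 * card (rel M E) \<le> card X ^ ar E")
      case True
      then show ?thesis using False by (simp add: r_def)
    next
      case big: False
      have "card (tuples X (ar E) - rel M E) = card X ^ ar E - card (rel M E)"
        using R[OF E] fX by (subst card_Diff_subset) (auto simp: card_tuples intro: finite_subset)
      moreover have "sym_diff (rel M E) (r E) = tuples X (ar E) - rel M E"
        using R[OF E] False big by (auto simp: r_def)
      ultimately show ?thesis using big by simp
    qed
    then have "2 * real (card (sym_diff (rel M E) (r E))) \<le> real (card X) ^ ar E"
      by (metis of_nat_le_iff of_nat_mult of_nat_numeral of_nat_power)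
    moreover have "1 / 2 * real (card X) ^ ar E \<le> real (ar E) * \<epsilon> * real (card X) ^ ar E"
    proof (rule mult_right_mono)
      have "1 * (1 / 2) \<le> real (ar E) * \<epsilon>" using False \<epsilon> by (intro mult_mono) auto
      then show "1 / 2 \<le> real (ar E) * \<epsilon>" by simp
    qed simp
    ultimately show ?thesis by linarith
  qed
  moreover have "indivisible L ar N {X}"
    unfolding indivisible_def
  proof (intro ballI allI impI)
    fix E ps a0 a1
    assume E: "E \<in> L" and *: "length ps = ar E \<and> set ps \<subseteq> {X} \<and> list_all2 (\<in>) a0 ps \<and> list_all2 (\<in>) a1 ps"
    have in_tuples: "a \<in> tuples X (ar E)" if "list_all2 (\<in>) a ps" for a
    proof -
      have "length a = ar E" using that * by (auto dest: list_all2_lengthD)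
      moreover have "a ! i \<in> X" if i: "i < ar E" for i
      proof -
        have "ps ! i \<in> set ps" using * i by simp
        then have "ps ! i = X" using * by blast
        then show ?thesis using \<open>list_all2 (\<in>) a ps\<close> * i by (metis (lifting) list_all2_conv_all_nth)
      qed
      ultimately show ?thesis by (auto simp: tuples_def in_set_conv_nth)
    qed
    show "a0 \<in> rel N E \<longleftrightarrow> a1 \<in> rel N E"
      using in_tuples[of a0] in_tuples[of a1] * by (auto simp: N_def r_def tuples_def)
  qed
  ultimately show ?thesis
    by (intro exI[of _ N] exI[of _ "{X}"]) (simp add: N_def X_def equitable_def)
qed

theorem mainTheorem3:
  fixes L :: "'s set" and ar :: "'s \<Rightarrow> nat" and \<tau> :: nat and \<epsilon> :: real
  assumes "finite L" and "0 < \<epsilon>" and "\<epsilon> \<le> 2"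
  shows "\<exists>(k :: nat) (\<delta> :: real). \<delta> > 0 \<and>
    (\<forall>M :: ('s, 'a) rel_structure.
       is_structure L ar M \<and> finite (univ M) \<and> card (univ M) \<ge> k \<and>
       \<not> dense_branching L ar M \<delta> \<tau> \<longrightarrow>
       (\<exists>(N :: ('s, 'a) rel_structure) P.
          is_structure L ar N \<and> univ N = univ M \<and>
          partition_on (univ M) P \<and> equitable P \<and>
          (\<forall>E\<in>L. real (card (sym_diff (rel M E) (rel N E)))
             \<le> real (ar E) * \<epsilon> * real (card (univ M)) ^ ar E) \<and>
          indivisible L ar N P \<and>
          real (card P) \<le> (\<epsilon> / 2) powi (- g_exp L ar \<tau> - 2)))"
proof -
  let ?b = "(\<epsilon> / 2) powi (- g_exp L ar \<tau> - 2)"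
  let ?concl = "\<lambda>(M :: ('s, 'a) rel_structure) m. \<exists>(N :: ('s, 'a) rel_structure) P.
      is_structure L ar N \<and> univ N = univ M \<and> partition_on (univ M) P \<and> equitable P \<and>
      (\<forall>E\<in>L. real (card (sym_diff (rel M E) (rel N E)))
         \<le> real (ar E) * \<epsilon> * real (card (univ M)) ^ ar E) \<and>
      indivisible L ar N P \<and> card P \<le> m"
  \<comment> \<open>Separates the real bound from the construction: what remains is to find
    \<open>k\<close>, \<open>\<delta>\<close> and a natural number \<open>m\<close> below the bound,
    all independent of \<open>M\<close>.\<close>
  have suffices: ?thesis if "0 < \<delta>" "real m \<le> ?b"
    "\<And>M :: ('s, 'a) rel_structure. is_structure L ar M \<Longrightarrow> finite (univ M) \<Longrightarrow> k \<le> card (univ M) \<Longrightarrow>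
      \<not> dense_branching L ar M \<delta> \<tau> \<Longrightarrow> ?concl M m" for k m :: nat and \<delta> :: real
  proof (intro exI[of _ k] exI[of _ \<delta>] conjI allI impI)
    fix M :: "('s, 'a) rel_structure"
    assume "is_structure L ar M \<and> finite (univ M) \<and> card (univ M) \<ge> k \<and> \<not> dense_branching L ar M \<delta> \<tau>"
    then have "?concl M m" using that(3)[of M] by blast
    then obtain N P where NP: "is_structure L ar N" "univ N = univ M" "partition_on (univ M) P" "equitable P"
      "\<forall>E\<in>L. real (card (sym_diff (rel M E) (rel N E)))
         \<le> real (ar E) * \<epsilon> * real (card (univ M)) ^ ar E"
      "indivisible L ar N P" "card P \<le> m" by blast
    have "real (card P) \<le> ?b" using NP(7) \<open>real m \<le> ?b\<close> by linarith
    with NP(1-6) show "\<exists>(N :: ('s, 'a) rel_structure) P.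
          is_structure L ar N \<and> univ N = univ M \<and>
          partition_on (univ M) P \<and> equitable P \<and>
          (\<forall>E\<in>L. real (card (sym_diff (rel M E) (rel N E)))
             \<le> real (ar E) * \<epsilon> * real (card (univ M)) ^ ar E) \<and>
          indivisible L ar N P \<and> real (card P) \<le> ?b" by blast
  qed (rule \<open>0 < \<delta>\<close>)
  have b: "?b = (2 / \<epsilon>) ^ nat (g_exp L ar \<tau> + 2)" by (rule parts_bound[OF \<open>0 < \<epsilon>\<close>])
  then have b1: "real 1 \<le> ?b" using assms by (simp add: one_le_power)
  have nonempty: "X \<noteq> {}" if "1 \<le> card X" for X :: "'a set" using that by auto
  show ?thesis
  proof (cases "1 / 2 \<le> \<epsilon>")
    case True
    show ?thesis
    proof (rule suffices[of 1 1 1, OF _ b1])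
      fix M :: "('s, 'a) rel_structure"
      assume "is_structure L ar M" "finite (univ M)" "1 \<le> card (univ M)"
      then show "?concl M 1" using True nonempty by (intro single_part_approximation)
    qed simp
  next
    case \<epsilon>: False
    define e where "e = \<epsilon> / 16"
    have e: "0 < e" "e \<le> 1" using assms(2) \<epsilon> by (auto simp: e_def)
    obtain \<delta> where "0 < \<delta>" and covers: "\<And>M :: ('s, 'a) rel_structure. is_structure L ar M \<Longrightarrow>
        finite (univ M) \<Longrightarrow> univ M \<noteq> {} \<Longrightarrow> \<not> dense_branching L ar M \<delta> \<tau> \<Longrightarrow>
        \<exists>\<A>. good_covers L ar M e \<A> \<and>
          (\<forall>E\<in>L. \<forall>j<ar E. real (card (\<A> E j)) \<le> 1 / e ^ \<tau> \<and> (\<tau> \<le> 1 \<longrightarrow> \<A> E j = {univ M}))"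
      using good_covers_of_not_dense[OF assms(1) e, of ar \<tau>, where ?'a = 'a] by metis
    have concl: "?concl M m"
      if M: "is_structure L ar M" "finite (univ M)" and cov: "good_covers L ar M e \<A>"
        and h: "h ` univ M \<subseteq> {..<m}" "\<And>b. b < m \<Longrightarrow> card {x \<in> univ M. h x = b} \<in> {s, s + 1}"
        and mixed: "real (card {x \<in> univ M. \<exists>x'\<in>univ M. h x' = h x \<and>
          joint_label L ar \<A> x' \<noteq> joint_label L ar \<A> x}) \<le> e * card (univ M)"
      for M :: "('s, 'a) rel_structure" and \<A> h m s
    proof (rule regular_partition_of_covers[where \<A> = \<A> and C = "joint_label L ar \<A>"])
      fix E j assume E: "E \<in> L" "j < ar E"
      show "disjoint (\<A> E j) \<and> \<Union>(\<A> E j) \<subseteq> univ M \<and>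
        (\<forall>A\<in>\<A> E j. good (\<lambda>x y. ins j x y \<in> rel M E) (tuples (univ M) (ar E - 1)) (\<epsilon> / 16) A) \<and>
        real (card (univ M - \<Union>(\<A> E j))) \<le> \<epsilon> / 16 * card (univ M)"
        using cov E unfolding good_covers_def e_def by blast
      show "label (\<A> E j) x = label (\<A> E j) y" if "joint_label L ar \<A> x = joint_label L ar \<A> y" for x y
        using joint_label_eqD[OF that E] .
    qed (use M \<open>0 < \<epsilon>\<close> h mixed in \<open>simp_all only: e_def\<close>)
    show ?thesis
    \<comment> \<open>These are the cases with \<open>g_exp L ar \<tau> = 0\<close>. Either every
      cover is \<open>{univ M}\<close>, or there is no pair \<open>(E, j)\<close>; both ways all
      elements share one joint label, and the constant labelling has no mixed block.\<close>
    proof (cases "\<tau> \<le> 1 \<or> lang_size L ar = 0")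
      case True
      show ?thesis
      proof (rule suffices[of \<delta> 1 1, OF \<open>0 < \<delta>\<close> b1])
        fix M :: "('s, 'a) rel_structure"
        assume M: "is_structure L ar M" "finite (univ M)" "1 \<le> card (univ M)"
          "\<not> dense_branching L ar M \<delta> \<tau>"
        obtain \<A> where \<A>: "good_covers L ar M e \<A>"
          "\<forall>E\<in>L. \<forall>j<ar E. real (card (\<A> E j)) \<le> 1 / e ^ \<tau> \<and> (\<tau> \<le> 1 \<longrightarrow> \<A> E j = {univ M})"
          using covers[OF M(1,2) nonempty[OF M(3)] M(4)] by (elim exE conjE) (rule that)
        have label: "label (\<A> E j) x = label (\<A> E j) x'"
          if E: "E \<in> L" "j < ar E" and x: "x \<in> univ M" "x' \<in> univ M" for E j x x'
        proof (cases "\<tau> \<le> 1")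
          case True
          then have "\<A> E j = {univ M}" using \<A>(2) E by blast
          then show ?thesis using label_eq[of "{univ M}" "univ M"] x by (simp add: disjoint_def)
        next
          case False
          then have "card (Sigma L (\<lambda>E. {..<ar E})) = 0"
            using True card_symbol_positions[OF assms(1), of ar] by simp
          moreover have "(E, j) \<in> Sigma L (\<lambda>E. {..<ar E})" using E by simp
          moreover have "finite (Sigma L (\<lambda>E. {..<ar E}))" using assms(1) by simp
          ultimately show ?thesis by (metis card_0_eq empty_iff)
        qed
        have "joint_label L ar \<A> x = joint_label L ar \<A> x'" if "x \<in> univ M" "x' \<in> univ M" for x x'
          unfolding joint_label_def
        proof (rule restrict_ext)
          fix p assume "p \<in> Sigma L (\<lambda>E. {..<ar E})"
          then obtain E j where "p = (E, j)" "E \<in> L" "j < ar E" by auto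
          then show "(case p of (E, j) \<Rightarrow> label (\<A> E j) x) = (case p of (E, j) \<Rightarrow> label (\<A> E j) x')"
            using label[of E j x x'] that by simp
        qed
        then have mixed: "{x \<in> univ M. \<exists>x'\<in>univ M. (0 :: nat) = 0 \<and>
            joint_label L ar \<A> x' \<noteq> joint_label L ar \<A> x} = {}"
          by blast
        show "?concl M 1"
        proof (rule concl[OF M(1,2) \<A>(1), of "\<lambda>_. 0" _ "card (univ M)"])
          show "real (card {x \<in> univ M. \<exists>x'\<in>univ M. (0 :: nat) = 0 \<and>
              joint_label L ar \<A> x' \<noteq> joint_label L ar \<A> x}) \<le> e * card (univ M)"
            unfolding mixed using e by simp
        qed auto
      qed
    next
      case False
      define K where "K = (nat \<lfloor>1 / e ^ \<tau>\<rfloor> + 1) ^ lang_size L ar"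
      \<comment> \<open>For \<open>n = card (univ M) \<ge> m\<close>, which the threshold
        \<open>k = m\<close> ensures, \<open>K \<le> \<epsilon> / 32 * m\<close> bounds the number
        of mixed elements: \<open>K * (n / m + 1) \<le> \<epsilon> / 32 * n + \<epsilon> / 32 * n =
        e * n\<close>.\<close>
      define m where "m = nat \<lceil>32 * real K / \<epsilon>\<rceil>"
      have "real m \<le> ?b"
        unfolding b m_def using False \<epsilon> assms(2) K_def unfolding e_def by (intro number_of_parts) auto
      have mK: "32 * real K / \<epsilon> \<le> real m" unfolding m_def by linarith
      have "0 < K" by (simp add: K_def)
      then have "0 < 32 * real K / \<epsilon>" using assms(2) by simp
      then have m: "0 < m" using mK by linarith
      show ?thesis
      proof (rule suffices[of \<delta> m m, OF \<open>0 < \<delta>\<close> \<open>real m \<le> ?b\<close>])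
        fix M :: "('s, 'a) rel_structure"
        assume M: "is_structure L ar M" "finite (univ M)" "m \<le> card (univ M)"
          "\<not> dense_branching L ar M \<delta> \<tau>"
        define n where "n = card (univ M)"
        have "univ M \<noteq> {}" using M(3) m by auto
        obtain \<A> where \<A>: "good_covers L ar M e \<A>"
          "\<forall>E\<in>L. \<forall>j<ar E. real (card (\<A> E j)) \<le> 1 / e ^ \<tau> \<and> (\<tau> \<le> 1 \<longrightarrow> \<A> E j = {univ M})"
          using covers[OF M(1,2) \<open>univ M \<noteq> {}\<close> M(4)] by (elim exE conjE) (rule that)
        have labels: "card (joint_label L ar \<A> ` univ M) \<le> K"
          unfolding K_def
        proof (rule card_joint_label_image[OF assms(1)])
          fix E j assume E: "E \<in> L" "j < ar E"
          have "disjoint (\<A> E j)" "\<Union>(\<A> E j) \<subseteq> univ M" using \<A>(1) E by (auto simp: good_covers_def)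
          moreover from this have "finite (\<A> E j)"
            using M(2) by (meson finite_UnionD finite_subset)
          moreover have "card (\<A> E j) \<le> nat \<lfloor>1 / e ^ \<tau>\<rfloor>"
            using \<A>(2) E by (simp add: le_nat_floor)
          ultimately show "disjoint (\<A> E j) \<and> finite (\<A> E j) \<and> card (\<A> E j) < nat \<lfloor>1 / e ^ \<tau>\<rfloor> + 1"
            by simp
        qed simp
        obtain h :: "'a \<Rightarrow> nat" where h: "h ` univ M \<subseteq> {..<m}"
          "\<And>b. b < m \<Longrightarrow> card {x \<in> univ M. h x = b} \<in> {card (univ M) div m, card (univ M) div m + 1}"
          "card {x \<in> univ M. \<exists>x'\<in>univ M. h x' = h x \<and> joint_label L ar \<A> x' \<noteq> joint_label L ar \<A> x}
            \<le> K * (card (univ M) div m + 1)"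
          by (rule equitable_labelling[OF M(2) \<open>univ M \<noteq> {}\<close> m labels]) (rule that)
        have "real (K * (n div m + 1)) \<le> real K * (real n / real m + 1)"
        proof -
          have "real (n div m) \<le> real n / real m" by (rule of_nat_div_le_of_nat)
          then show ?thesis
            unfolding of_nat_mult of_nat_add of_nat_1 by (intro mult_left_mono add_right_mono) simp_all
        qed
        also have "\<dots> \<le> (\<epsilon> / 32 * real m) * (real n / real m) + \<epsilon> / 32 * real n"
        proof -
          have "real K \<le> \<epsilon> / 32 * real m" using mK assms(2) by (simp add: field_simps)
          moreover have "\<epsilon> / 32 * real m \<le> \<epsilon> / 32 * real n"
            using M(3) assms(2) by (simp add: n_def)
          ultimately show ?thesis
            unfolding distrib_left by (intro add_mono mult_right_mono) auto
        qed
        also have "\<dots> = e * real n" using m by (simp add: e_def)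
        finally have "real (card {x \<in> univ M. \<exists>x'\<in>univ M. h x' = h x \<and>
            joint_label L ar \<A> x' \<noteq> joint_label L ar \<A> x}) \<le> e * card (univ M)"
          using h(3) unfolding n_def by linarith
        from concl[OF M(1,2) \<A>(1) h(1) h(2) this] show "?concl M m" .
      qed
    qed
  qed
qed

end
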